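(* Let $n\ge 4$ and let $(G,H)\in\mathcal{H}_n\times\mathcal{H}_n$. Then there is a (possibly trivial) permutation of the columns of $G$ after which the resulting matrix $\widetilde G$ has a row $(x_1\;x_2\;\dots\;x_n)$ such that $(x_1\;-x_2\;x_3\;\dots\;x_{n-1}\;-x_n)$ (signs alternating) is also a row of $\widetilde G$. Moreover, for every such choice of $\widetilde G$ and of $(x_1\;\dots\;x_n)$, every $T$-submatrix $T=\left[\begin{array}{c}C\\ D\end{array}\right]=[\,T^{[1]}\;T^{[2]}\,]$ of $H$, and every complete tensor set of LSESC $\mathbb{X}=\{\mathcal{X}^{(1)},\dots,\mathcal{X}^{(\frac n2-2)}\}$ of order $\frac n2-1$, the following holds. Let $\mathbf{X}^{(s)}_k$ be the $k$-th frontal slice of $\mathcal{X}^{(s)}$ and put $\mathbf{Y}^{(s)}_k=I_2\otimes\mathbf{X}^{(s)}_k$. Let $G'$ be the matrix obtained from $\widetilde G$ by deleting the two rows $(x_1\;x_2\;\dots\;x_n)$ and $(x_1\;-x_2\;\dots\;x_{n-1}\;-x_n)$, let $B_0=G'\otimes\mathbf{J}_{\frac n2-1}$, and let $$B=\left[\begin{array}{c|cccc} E_1(x_1,x_2)&T_{x_3,x_4}&T_{x_5,x_6}&\cdots&T_{x_{n-1},x_n}\\ E_2(x_1,x_2)&\mathbf{Y}^{(1)}_{1}T_{x_3,x_4}&\mathbf{Y}^{(1)}_{2}T_{x_5,x_6}&\cdots&\mathbf{Y}^{(1)}_{\frac n2-1}T_{x_{n-1},x_n}\\ E_3(x_1,x_2)&\mathbf{Y}^{(2)}_{1}T_{x_3,x_4}&\mathbf{Y}^{(2)}_{2}T_{x_5,x_6}&\cdots&\mathbf{Y}^{(2)}_{\frac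 n2-1}T_{x_{n-1},x_n}\\ \vdots&\vdots&\vdots&&\vdots\\ E_{\frac n2-1}(x_1,x_2)&\mathbf{Y}^{(\frac n2-2)}_{1}T_{x_3,x_4}&\mathbf{Y}^{(\frac n2-2)}_{2}T_{x_5,x_6}&\cdots&\mathbf{Y}^{(\frac n2-2)}_{\frac n2-1}T_{x_{n-1},x_n} \end{array}\right],$$ where $$E_i(x_1,x_2)=\left[\begin{array}{c} \mathbf{J}_{\frac n2-1}^{\top}\otimes[\,x_1\mathbf{c}^{[1]}_i\;\;x_2\mathbf{c}^{[2]}_i\,]\\ \mathbf{J}_{\frac n2-1}^{\top}\otimes[\,x_1\mathbf{d}^{[1]}_i\;\;x_2\mathbf{d}^{[2]}_i\,] \end{array}\right],\qquad T_{x_d,x_{d+1}}=[\,x_dT^{[1]}\;\;x_{d+1}T^{[2]}\,].$$ Then the matrix $$\Psi_{\mathbb{X}}(G,H)=\left[\begin{array}{c}B_0\\ B\end{array}\right]$$ is a Hadamard matrix of order $(\frac n2-1)n$.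
   Context: A Hadamard matrix of order $n$ is an $n\times n$ matrix $M$ with entries in $\{1,-1\}$ and $MM^{\top}=nI_n$. It is normalized if its first row and first column consist entirely of ones. $\mathcal{H}_n$ is the set of all normalized Hadamard matrices of order $n$. $\mathbf{J}_k$ is the $1\times k$ row vector of all ones. The Kronecker product of $X=(x_{ij})$ and $Y$ is $X\otimes Y=(x_{ij}Y)$. $T$-submatrix: for $H\in\mathcal{H}_n$, choose a row and a column of $H$ whose common entry is $-1$; the rows and columns of $H$ can be permuted (moving the chosen row and column to second position and then sorting) so as to obtain a matrix whose first row and first column are all ones, and whose second row and second column both are $(1,-1,1,\dots,1,-1,\dots,-1)$ with, after the first two entries, $\frac{n-2}2$ entries $1$ followed by $\frac{n-2}2$ entries $-1$. Any $(n-2)\times(n-2)$ matrix $T$ obtained by deleting the first two rows and the first two columns of such a rearranged matrix is called a $T$-submatrix of $H$. Write $T=\left[\begin{array}{c}C\\ D\end{array}\right]$ with $C,D$ of size $\frac{n-2}2\times(n-2)$ (top and bottom halves), and $T=[\,T^{[1]}\;T^{[2]}\,]$, $C=[\,C^{[1]}\;C^{[2]}\,]$, $D=[\,D^{[1]}\;D^{[2]}\,]$, where the superscript $[1]$ denotes the first $\frac n2-1$ columns and $[2]$ the remaining $\frac n2-1$ columns. $\mathbf{c}^{[1]}_i,\mathbf{c}^{[2]}_i,\mathbf{d}^{[1]}_i,\mathbf{d}^{[2]}_i$ denote the $i$-th rows of $C^{[1]},C^{[2]},D^{[1]},D^{[2]}$. A Latin square of order $k$ is a $k\times k$ matrix with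 entries in $\{1,\dots,k\}$ in which each symbol appears exactly once in each row and in each column. Two Latin squares $L=(l_{ij})$ and $L'=(l'_{ij})$ of order $k$ are LSESC if for all $i,i'\in\{1,\dots,k\}$ there is a unique $j$ with $l_{ij}=l'_{i'j}$. A complete set of LSESC of order $k$ is a set $\{L^{(1)},\dots,L^{(k-1)}\}$ of $k-1$ Latin squares of order $k$, any two distinct members of which are LSESC. To a Latin square $L$ of order $k$ associate the cubic tensor $F(L)$ whose frontal slices are the $k\times k$ permutation matrices $\mathbf{X}_1,\dots,\mathbf{X}_k$, the $(i,j)$ entry of $\mathbf{X}_t$ being $1$ if $l_{it}=j$ and $0$ otherwise. A complete tensor set of LSESC of order $k$ is $\{F(L^{(1)}),\dots,F(L^{(k-1)})\}$ for a complete set of LSESC $\{L^{(1)},\dots,L^{(k-1)}\}$ of order $k$. *)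

theory Defs
  imports
    "Jordan_Normal_Form.Matrix"
    "Jordan_Normal_Form.DL_Submatrix"
    "HOL-Combinatorics.Permutations"
begin

text \<open>All row, column and slice indices are 0-based: the mathematical index \<open>i\<close> is \<open>i - 1\<close> here.\<close>

definition hadamard :: "nat \<Rightarrow> int mat \<Rightarrow> bool" where
  "hadamard n M \<longleftrightarrow> M \<in> carrier_mat n n \<and> elements_mat M \<subseteq> {1, -1} \<and>
     M * transpose_mat M = int n \<cdot>\<^sub>m 1\<^sub>m n"

definition normalized_hadamard :: "nat \<Rightarrow> int mat set" where
  "normalized_hadamard n =
     {M. hadamard n M \<and> row M 0 = vec n (\<lambda>_. 1) \<and> col M 0 = vec n (\<lambda>_. 1)}"

definition ones_row :: "nat \<Rightarrow> int mat" where
  "ones_row k = mat 1 k (\<lambda>_. 1)"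

definition kronecker :: "'a::times mat \<Rightarrow> 'a mat \<Rightarrow> 'a mat" (infixl \<open>\<otimes>\<^sub>K\<close> 70) where
  "X \<otimes>\<^sub>K Y = mat (dim_row X * dim_row Y) (dim_col X * dim_col Y)
     (\<lambda>(i, j). X $$ (i div dim_row Y, j div dim_col Y) * Y $$ (i mod dim_row Y, j mod dim_col Y))"

definition append_cols :: "'a::zero mat \<Rightarrow> 'a mat \<Rightarrow> 'a mat" (infixr \<open>@\<^sub>c\<close> 65) where
  "A @\<^sub>c B = four_block_mat A B (0\<^sub>m 0 (dim_col A)) (0\<^sub>m 0 (dim_col B))"

definition hcat :: "nat \<Rightarrow> 'a::zero mat list \<Rightarrow> 'a mat" where
  "hcat nr As = foldr (@\<^sub>c) As (0\<^sub>m nr 0)"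

definition vcat :: "nat \<Rightarrow> 'a::zero mat list \<Rightarrow> 'a mat" where
  "vcat nc As = foldr (@\<^sub>r) As (0\<^sub>m 0 nc)"

definition permute_mat :: "(nat \<Rightarrow> nat) \<Rightarrow> (nat \<Rightarrow> nat) \<Rightarrow> 'a mat \<Rightarrow> 'a mat" where
  "permute_mat p q A = mat (dim_row A) (dim_col A) (\<lambda>(i, j). A $$ (p i, q j))"

definition column_permutation_of :: "'a mat \<Rightarrow> 'a mat \<Rightarrow> bool" where
  "column_permutation_of B A \<longleftrightarrow> (\<exists>q. q permutes {..<dim_col A} \<and> B = permute_mat id q A)"

definition alternate :: "int vec \<Rightarrow> int vec" where
  "alternate x = vec (dim_vec x) (\<lambda>j. (-1) ^ j * x $ j)"

definition T_pattern :: "nat \<Rightarrow> int vec" where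
  "T_pattern n = vec_of_list
     ([1, -1] @ replicate ((n - 2) div 2) 1 @ replicate ((n - 2) div 2) (-1))"

definition T_submatrix :: "nat \<Rightarrow> int mat \<Rightarrow> int mat \<Rightarrow> bool" where
  "T_submatrix n H T \<longleftrightarrow>
     (\<exists>r < n. \<exists>c < n. H $$ (r, c) = -1 \<and>
       (\<exists>p q. p permutes {..<n} \<and> q permutes {..<n} \<and> p 1 = r \<and> q 1 = c \<and>
         (let R = permute_mat p q H in
            row R 0 = vec n (\<lambda>_. 1) \<and> col R 0 = vec n (\<lambda>_. 1) \<and>
            row R 1 = T_pattern n \<and> col R 1 = T_pattern n \<and>
            T = submatrix R (- {0, 1}) (- {0, 1}))))"

definition latin_square :: "nat \<Rightarrow> nat mat \<Rightarrow> bool" where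
  "latin_square k L \<longleftrightarrow> L \<in> carrier_mat k k \<and> elements_mat L \<subseteq> {1..k} \<and>
     (\<forall>i<k. \<forall>s\<in>{1..k}. \<exists>!j. j < k \<and> L $$ (i, j) = s) \<and>
     (\<forall>j<k. \<forall>s\<in>{1..k}. \<exists>!i. i < k \<and> L $$ (i, j) = s)"

definition lsesc :: "nat \<Rightarrow> nat mat \<Rightarrow> nat mat \<Rightarrow> bool" where
  "lsesc k L L' \<longleftrightarrow> (\<forall>i<k. \<forall>i'<k. \<exists>!j. j < k \<and> L $$ (i, j) = L' $$ (i', j))"

definition complete_lsesc :: "nat \<Rightarrow> nat mat set \<Rightarrow> bool" where
  "complete_lsesc k \<L> \<longleftrightarrow> finite \<L> \<and> card \<L> = k - 1 \<and> (\<forall>L\<in>\<L>. latin_square k L) \<and>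
     (\<forall>L\<in>\<L>. \<forall>L'\<in>\<L>. L \<noteq> L' \<longrightarrow> lsesc k L L')"

text \<open>A cubic tensor is represented by the list of its frontal slices.  The symbols of a Latin
  square are \<open>1, \<dots>, k\<close>, so symbol \<open>j + 1\<close> corresponds to column index \<open>j\<close>.\<close>

definition latin_tensor :: "nat \<Rightarrow> nat mat \<Rightarrow> int mat list" where
  "latin_tensor k L =
     map (\<lambda>t. mat k k (\<lambda>(i, j). if L $$ (i, t) = j + 1 then 1 else 0)) [0..<k]"

definition complete_tensor_set :: "nat \<Rightarrow> int mat list set \<Rightarrow> bool" where
  "complete_tensor_set k \<X> \<longleftrightarrow> (\<exists>\<L>. complete_lsesc k \<L> \<and> \<X> = latin_tensor k ` \<L>)"

text \<open>In the following, \<open>k\<close> is \<open>n / 2 - 1\<close>, so \<open>T\<close> has size \<open>2 k \<times> 2 k\<close>, and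
  \<^term>\<open>split_block T k k\<close> consists of the left and right halves of \<open>C\<close>, followed by those of \<open>D\<close>.\<close>

definition signed_T :: "nat \<Rightarrow> int mat \<Rightarrow> int \<Rightarrow> int \<Rightarrow> int mat" where
  "signed_T k T a b = (case split_block T k k of (C1, C2, D1, D2) \<Rightarrow>
     (a \<cdot>\<^sub>m (C1 @\<^sub>r D1)) @\<^sub>c (b \<cdot>\<^sub>m (C2 @\<^sub>r D2)))"

definition single_row_mat :: "'a mat \<Rightarrow> nat \<Rightarrow> 'a mat" where
  "single_row_mat A i = mat_of_rows (dim_col A) [row A i]"

definition E_block :: "nat \<Rightarrow> int mat \<Rightarrow> nat \<Rightarrow> int \<Rightarrow> int \<Rightarrow> int mat" where
  "E_block k T i a b = (case split_block T k k of (C1, C2, D1, D2) \<Rightarrow>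
     (transpose_mat (ones_row k) \<otimes>\<^sub>K ((a \<cdot>\<^sub>m single_row_mat C1 i) @\<^sub>c (b \<cdot>\<^sub>m single_row_mat C2 i))) @\<^sub>r
     (transpose_mat (ones_row k) \<otimes>\<^sub>K ((a \<cdot>\<^sub>m single_row_mat D1 i) @\<^sub>c (b \<cdot>\<^sub>m single_row_mat D2 i))))"

text \<open>Block row \<open>i\<close> of \<open>B\<close> uses the tensor with index \<open>i - 1\<close> of the list for \<open>i > 0\<close>, and
  no tensor for \<open>i = 0\<close>.\<close>

definition B_block_row ::
  "nat \<Rightarrow> int vec \<Rightarrow> int mat \<Rightarrow> int mat list list \<Rightarrow> nat \<Rightarrow> int mat" where
  "B_block_row k x T Xs i =
     E_block k T i (x $ 0) (x $ 1) @\<^sub>c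
     hcat (2 * k)
       (map (\<lambda>t. let S = signed_T k T (x $ (2 * t + 2)) (x $ (2 * t + 3)) in
               if i = 0 then S else (1\<^sub>m 2 \<otimes>\<^sub>K (Xs ! (i - 1) ! t)) * S) [0..<k])"

definition B_mat :: "nat \<Rightarrow> int vec \<Rightarrow> int mat \<Rightarrow> int mat list list \<Rightarrow> int mat" where
  "B_mat n x T Xs =
     (let k = n div 2 - 1 in vcat (k * n) (map (B_block_row k x T Xs) [0..<k]))"

definition B0_mat :: "nat \<Rightarrow> int mat \<Rightarrow> int vec \<Rightarrow> int mat" where
  "B0_mat n Gt x =
     mat_of_rows n (filter (\<lambda>r. r \<noteq> x \<and> r \<noteq> alternate x) (rows Gt)) \<otimes>\<^sub>K ones_row (n div 2 - 1)"

definition Psi ::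
  "nat \<Rightarrow> int mat \<Rightarrow> int vec \<Rightarrow> int mat \<Rightarrow> int mat list list \<Rightarrow> int mat" where
  "Psi n Gt x T Xs = B0_mat n Gt x @\<^sub>r B_mat n x T Xs"

end

theory Submission
  imports Defs
begin

text \<open>Write \<open>k = n / 2 - 1\<close>. A row of \<open>B\<close> is determined by a half of \<open>T\<close> (the rows of \<open>C\<close> or those
  of \<open>D\<close>) and a pair \<open>(i, a)\<close>; up to the signs \<open>x\<^sub>j\<close>, it is the concatenation of \<open>k + 1\<close> rows of that
  half. The complete set of LSESC makes the indices of these rows an orthogonal array: distinct
  pairs choose the same row of the half in exactly one of the \<open>k + 1\<close> places. Because \<open>H\<close> is
  Hadamard, two rows of \<open>T\<close> from the same half have inner product \<open>-2\<close> (or \<open>n - 2\<close> if they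
  coincide), and rows from different halves are orthogonal, so the inner product of two rows of
  \<open>B\<close> from the same half with distinct pairs is \<open>n - 2 (k + 1) = 0\<close>. Finally, the half rows of
  \<open>T\<close> have constant sums \<open>-1, -1\<close> in \<open>C\<close> and \<open>-1, 1\<close> in \<open>D\<close>, so the inner product of
  a row of \<open>B\<close> with a row of \<open>B\<^sub>0\<close> is up to sign one of the products of the corresponding row of \<open>G'\<close>
  with the two deleted rows.\<close>

section \<open>The Hadamard condition as index sums, and sums over blocks of indices\<close>

text \<open>With the matrix equation replaced by sums over indices, each later orthogonality proof
  only has to regroup a finite sum.\<close>

lemma hadamard_iff:
  "hadamard n M \<longleftrightarrow> M \<in> carrier_mat n n \<and> (\<forall>i<n. \<forall>j<n. M $$ (i, j) \<in> {1, -1}) \<and>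
     (\<forall>i<n. \<forall>i'<n. (\<Sum>j<n. M $$ (i, j) * M $$ (i', j)) = (if i = i' then int n else 0))"
proof (cases "M \<in> carrier_mat n n")
  case True
  then have dims: "dim_row M = n" "dim_col M = n" by auto
  have "elements_mat M = {M $$ (i, j) | i j. i < n \<and> j < n}"
  proof (intro equalityI subsetI)
    show "e \<in> {M $$ (i, j) | i j. i < n \<and> j < n}" if "e \<in> elements_mat M" for e
      using elements_matD[OF that] dims by auto
    show "e \<in> elements_mat M" if "e \<in> {M $$ (i, j) | i j. i < n \<and> j < n}" for e
      using that elements_matI[OF True] by auto
  qed
  then have "elements_mat M \<subseteq> {1, -1} \<longleftrightarrow> (\<forall>i<n. \<forall>j<n. M $$ (i, j) \<in> {1, -1})"
    unfolding subset_iff by (simp only: mem_Collect_eq) metis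
  moreover have "M * transpose_mat M = int n \<cdot>\<^sub>m 1\<^sub>m n \<longleftrightarrow>
    (\<forall>i<n. \<forall>i'<n. (\<Sum>j<n. M $$ (i, j) * M $$ (i', j)) = (if i = i' then int n else 0))"
  proof -
    have prod: "(M * transpose_mat M) $$ (i, i') = (\<Sum>j<n. M $$ (i, j) * M $$ (i', j))"
      if "i < n" "i' < n" for i i'
      using that dims by (simp add: scalar_prod_def atLeast0LessThan)
    have unit: "(int n \<cdot>\<^sub>m 1\<^sub>m n) $$ (i, i') = (if i = i' then int n else 0)"
      if "i < n" "i' < n" for i i'
      using that by simp
    have "M * transpose_mat M = int n \<cdot>\<^sub>m 1\<^sub>m n \<longleftrightarrow>
      (\<forall>i<n. \<forall>i'<n. (M * transpose_mat M) $$ (i, i') = (int n \<cdot>\<^sub>m 1\<^sub>m n) $$ (i, i'))"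
      unfolding mat_eq_iff by (simp add: dims)
    then show ?thesis by (simp add: prod unit)
  qed
  ultimately show ?thesis using True unfolding hadamard_def by simp
qed (simp add: hadamard_def)

lemma sum_lessThan_mult:
  fixes f :: "nat \<Rightarrow> 'a::comm_monoid_add"
  shows "(\<Sum>c<m * w. f c) = (\<Sum>u<m. \<Sum>v<w. f (u * w + v))"
  unfolding sum.nat_group[symmetric]
  by (simp add: sum.atLeastLessThan_shift_0[of _ "_ * w"] atLeast0LessThan)

lemma sum_lessThan_add:
  fixes f :: "nat \<Rightarrow> 'a::comm_monoid_add"
  shows "(\<Sum>c<m + w. f c) = (\<Sum>u<m. f u) + (\<Sum>v<w. f (m + v))"
  by (induction w) (auto simp: add.assoc)

section \<open>Closed forms of concatenations and of the blocks of \<open>B\<close>\<close>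

lemma append_rows_eq_mat:
  assumes "A \<in> carrier_mat nr1 nc" "B \<in> carrier_mat nr2 nc"
  shows "A @\<^sub>r B =
    mat (nr1 + nr2) nc (\<lambda>(i, j). if i < nr1 then A $$ (i, j) else B $$ (i - nr1, j))"
  using assms by (intro eq_matI) (auto simp: append_rows_def)

lemma append_cols_eq_mat:
  assumes "A \<in> carrier_mat nr nc1" "B \<in> carrier_mat nr nc2"
  shows "A @\<^sub>c B =
    mat nr (nc1 + nc2) (\<lambda>(i, j). if j < nc1 then A $$ (i, j) else B $$ (i, j - nc1))"
  using assms by (intro eq_matI) (auto simp: append_cols_def)

text \<open>Equal positive widths turn the number of the block and the offset inside it into
  quotient and remainder, so entries of nested concatenations can be read off by arithmetic.\<close>

lemma hcat_eq_mat:
  assumes "w > 0" "\<And>A. A \<in> set As \<Longrightarrow> A \<in> carrier_mat nr w"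
  shows "hcat nr As = mat nr (length As * w) (\<lambda>(r, c). As ! (c div w) $$ (r, c mod w))"
  using assms(2)
proof (induction As)
  case (Cons A As)
  then have "hcat nr As = mat nr (length As * w) (\<lambda>(r, c). As ! (c div w) $$ (r, c mod w))"
    and "A \<in> carrier_mat nr w" by auto
  note IH = this
  have "hcat nr (A # As) = A @\<^sub>c hcat nr As"
    by (simp add: hcat_def)
  also have "\<dots> = A @\<^sub>c mat nr (length As * w) (\<lambda>(r, c). As ! (c div w) $$ (r, c mod w))"
    by (simp only: IH)
  finally show ?case
    using IH(2) assms(1) by (simp only:, subst append_cols_eq_mat[of _ nr w _ "length As * w"])
      (auto intro!: eq_matI simp: le_div_geq le_mod_geq not_less)
qed (auto simp: hcat_def)

lemma vcat_eq_mat: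
  assumes "w > 0" "\<And>A. A \<in> set As \<Longrightarrow> A \<in> carrier_mat w nc"
  shows "vcat nc As = mat (length As * w) nc (\<lambda>(r, c). As ! (r div w) $$ (r mod w, c))"
  using assms(2)
proof (induction As)
  case (Cons A As)
  then have "vcat nc As = mat (length As * w) nc (\<lambda>(r, c). As ! (r div w) $$ (r mod w, c))"
    and "A \<in> carrier_mat w nc" by auto
  note IH = this
  have "vcat nc (A # As) = A @\<^sub>r vcat nc As"
    by (simp add: vcat_def)
  also have "\<dots> = A @\<^sub>r mat (length As * w) nc (\<lambda>(r, c). As ! (r div w) $$ (r mod w, c))"
    by (simp only: IH)
  finally show ?case
    using IH(2) assms(1) by (simp only:, subst append_rows_eq_mat[of _ w nc _ "length As * w"])
      (auto intro!: eq_matI simp: le_div_geq le_mod_geq not_less)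
qed (auto simp: vcat_def)

lemma signed_T_eq_mat:
  assumes "T \<in> carrier_mat (2 * k) (2 * k)"
  shows "signed_T k T a b =
    mat (2 * k) (2 * k) (\<lambda>(i, j). (if j < k then a else b) * T $$ (i, j))"
proof -
  have "dim_row T = k + k" "dim_col T = k + k" using assms by auto
  then show ?thesis
    unfolding signed_T_def split_block_def Let_def
    apply (simp only: prod.case)
    apply (subst append_rows_eq_mat[of _ k k _ k], simp, simp)+
    apply (subst append_cols_eq_mat[of _ "k + k" k _ k])
    by (auto intro!: eq_matI)
qed

text \<open>The quotient \<open>r div k\<close> is \<open>0\<close> for the half coming from
  \<open>C\<close> and \<open>1\<close> for the half coming from \<open>D\<close>, so
  \<open>r div k * k + i\<close> is row \<open>i\<close> of the half in which \<open>r\<close> lies.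
  The Kronecker factor of ones makes this row the same for all \<open>r\<close> in that
  half.\<close>

lemma E_block_eq_mat:
  assumes "T \<in> carrier_mat (2 * k) (2 * k)" "i < k"
  shows "E_block k T i a b = mat (2 * k) (2 * k)
    (\<lambda>(r, j). (if j < k then a else b) * T $$ (r div k * k + i, j))"
proof -
  have dims: "dim_row T = k + k" "dim_col T = k + k" using assms by auto
  have half: "transpose_mat (ones_row k) \<otimes>\<^sub>K
      ((a \<cdot>\<^sub>m single_row_mat (mat k k f) i) @\<^sub>c (b \<cdot>\<^sub>m single_row_mat (mat k k g) i))
    = mat k (k + k) (\<lambda>(r, j). if j < k then a * f (i, j) else b * g (i, j - k))" for f g
  proof -
    have "(a \<cdot>\<^sub>m single_row_mat (mat k k f) i) @\<^sub>c (b \<cdot>\<^sub>m single_row_mat (mat k k g) i) =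
      mat 1 (k + k) (\<lambda>(_, j). if j < k then a * f (i, j) else b * g (i, j - k))"
      using assms(2) by (subst append_cols_eq_mat[of _ 1 k _ k])
        (auto intro!: eq_matI simp: single_row_mat_def mat_of_rows_def)
    then show ?thesis
      by (auto intro!: eq_matI simp: kronecker_def ones_row_def)
  qed
  show ?thesis
    unfolding E_block_def split_block_def Let_def dims prod.case add_diff_cancel_right' half
    apply (subst append_rows_eq_mat[of _ k "k + k" _ k])
    using assms(2) by (auto intro!: eq_matI simp: le_div_geq add.commute)
qed

text \<open>Row \<open>r\<close> of the block diagonal matrix vanishes outside the diagonal block
  numbered \<open>r div k\<close>; the sum over the other block drops out.\<close>

lemma sum_block_diag:
  fixes X :: "int mat"
  assumes "X \<in> carrier_mat k k" "r < 2 * k"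
  shows "(\<Sum>j<2 * k. (1\<^sub>m 2 \<otimes>\<^sub>K X) $$ (r, j) * f j)
    = (\<Sum>j<k. X $$ (r mod k, j) * f (r div k * k + j))"
proof -
  have k: "0 < k" using assms(2) by (cases k) auto
  have "r div k < 2" using assms(2) k by (simp add: less_mult_imp_div_less)
  then have rd: "r div k = 0 \<or> r div k = 1" by auto
  have "(\<Sum>j<2 * k. (1\<^sub>m 2 \<otimes>\<^sub>K X) $$ (r, j) * f j) =
    (\<Sum>u<2. \<Sum>v<k. (1\<^sub>m 2 \<otimes>\<^sub>K X) $$ (r, u * k + v) * f (u * k + v))"
    by (rule sum_lessThan_mult)
  also have "\<dots> = (\<Sum>u<2. \<Sum>v<k. if r div k = u then X $$ (r mod k, v) * f (u * k + v) else 0)"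
  proof (intro sum.cong refl)
    fix u v assume uv: "u \<in> {..<2::nat}" "v \<in> {..<k}"
    then have "u = 0 \<or> u = 1" by auto
    then have "u * k + v < 2 * k" using uv by auto
    then show "(1\<^sub>m 2 \<otimes>\<^sub>K X) $$ (r, u * k + v) * f (u * k + v) =
      (if r div k = u then X $$ (r mod k, v) * f (u * k + v) else 0)"
      using assms k uv rd by (auto simp: kronecker_def)
  qed
  also have "\<dots> = (\<Sum>j<k. X $$ (r mod k, j) * f (r div k * k + j))"
    using rd by (auto simp: numeral_2_eq_2)
  finally show ?thesis .
qed

section \<open>Latin squares as row selectors, and the block rows of \<open>B\<close>\<close>

text \<open>The lower bound guarantees that the truncated subtraction
  \<open>L $$ (i, j) - 1\<close>, which converts a symbol into an index, loses no
  information.\<close>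

lemma latin_square_entry:
  assumes "latin_square k L" "i < k" "j < k"
  shows "1 \<le> L $$ (i, j)" "L $$ (i, j) \<le> k"
proof -
  have "L $$ (i, j) \<in> elements_mat L"
    using assms by (intro elements_matI[of L k k i j]) (auto simp: latin_square_def)
  then have "L $$ (i, j) \<in> {1..k}" using assms(1) by (auto simp: latin_square_def)
  then show "1 \<le> L $$ (i, j)" "L $$ (i, j) \<le> k" by auto
qed

text \<open>Row \<open>i\<close> of the slice \<open>t\<close> has its only \<open>1\<close> in
  column \<open>L $$ (i, t) - 1\<close>. Multiplication from the left therefore selects that row,
  and does so inside each half of \<open>S\<close> separately.\<close>

lemma latin_slice_mult_eq_mat:
  assumes "latin_square k L" "t < k" "S \<in> carrier_mat (2 * k) m"
  shows "(1\<^sub>m 2 \<otimes>\<^sub>K (latin_tensor k L ! t)) * S =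
    mat (2 * k) m (\<lambda>(r, j). S $$ (r div k * k + (L $$ (r mod k, t) - 1), j))"
proof (rule eq_matI)
  let ?X = "latin_tensor k L ! t"
  have X: "?X = mat k k (\<lambda>(i, j). if L $$ (i, t) = j + 1 then 1 else 0)"
    using assms(2) by (simp add: latin_tensor_def)
  then have Xc: "?X \<in> carrier_mat k k" by simp
  show dr: "dim_row ((1\<^sub>m 2 \<otimes>\<^sub>K ?X) * S) = dim_row (mat (2 * k) m (\<lambda>(r, j). S $$ (r div k * k + (L $$ (r mod k, t) - 1), j)))"
    and "dim_col ((1\<^sub>m 2 \<otimes>\<^sub>K ?X) * S) = dim_col (mat (2 * k) m (\<lambda>(r, j). S $$ (r div k * k + (L $$ (r mod k, t) - 1), j)))"
    using assms(3) X by (auto simp: kronecker_def)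
  fix r j
  assume "r < dim_row (mat (2 * k) m (\<lambda>(r, j). S $$ (r div k * k + (L $$ (r mod k, t) - 1), j)))"
    and "j < dim_col (mat (2 * k) m (\<lambda>(r, j). S $$ (r div k * k + (L $$ (r mod k, t) - 1), j)))"
  then have rj: "r < 2 * k" "j < m" by auto
  have rk: "r mod k < k" using assms(2) by simp
  obtain s where s: "L $$ (r mod k, t) = s + 1" "s < k"
    using latin_square_entry[OF assms(1) rk assms(2)] by (cases "L $$ (r mod k, t)") auto
  have "((1\<^sub>m 2 \<otimes>\<^sub>K ?X) * S) $$ (r, j) = (\<Sum>v<2 * k. (1\<^sub>m 2 \<otimes>\<^sub>K ?X) $$ (r, v) * S $$ (v, j))"
    using rj assms(3) dr Xc by (auto simp: scalar_prod_def atLeast0LessThan kronecker_def intro!: sum.cong)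
  also have "\<dots> = (\<Sum>v<k. ?X $$ (r mod k, v) * S $$ (r div k * k + v, j))"
    by (rule sum_block_diag[OF Xc rj(1)])
  also have "\<dots> = (\<Sum>v<k. if v = s then S $$ (r div k * k + v, j) else 0)"
    using rk s by (intro sum.cong) (auto simp: X)
  also have "\<dots> = S $$ (r div k * k + s, j)" using s by simp
  finally show "((1\<^sub>m 2 \<otimes>\<^sub>K ?X) * S) $$ (r, j) =
    mat (2 * k) m (\<lambda>(r, j). S $$ (r div k * k + (L $$ (r mod k, t) - 1), j)) $$ (r, j)"
    using rj s by simp
qed

text \<open>\<open>lsesc_array Ls i a u\<close> is the index, within its half of \<open>T\<close>, of the row of \<open>T\<close> that row \<open>a\<close> of
  block row \<open>i\<close> uses in block column \<open>u\<close>; column \<open>u = 0\<close> is that of the blocks \<open>E\<^sub>i\<close>.\<close>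

definition lsesc_array :: "nat mat list \<Rightarrow> nat \<Rightarrow> nat \<Rightarrow> nat \<Rightarrow> nat" where
  "lsesc_array Ls i a u =
     (if u = 0 then i else if i = 0 then a else Ls ! (i - 1) $$ (a, u - 1) - 1)"

text \<open>Here \<open>c div k\<close> counts half blocks and so gives the position of the sign in
  \<open>x\<close>, while \<open>c div (2 * k)\<close> is the block column. The special values of
  \<open>lsesc_array\<close> at \<open>u = 0\<close> and \<open>i = 0\<close> let one formula cover
  the \<open>E_block\<close>, the plain signed copies of \<open>T\<close> and the permuted
  ones.\<close>

lemma B_block_row_eq_mat:
  assumes T: "T \<in> carrier_mat (2 * k) (2 * k)" and i: "i < k"
    and Ls: "length Ls = k - 1" "\<And>L. L \<in> set Ls \<Longrightarrow> latin_square k L"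
  shows "B_block_row k x T (map (latin_tensor k) Ls) i = mat (2 * k) ((k + 1) * (2 * k))
    (\<lambda>(r, c). x $ (c div k) *
       T $$ (r div k * k + lsesc_array Ls i (r mod k) (c div (2 * k)), c mod (2 * k)))"
proof -
  let ?S = "\<lambda>t. signed_T k T (x $ (2 * t + 2)) (x $ (2 * t + 3))"
  define f where "f t = (if i = 0 then ?S t
    else (1\<^sub>m 2 \<otimes>\<^sub>K (map (latin_tensor k) Ls ! (i - 1) ! t)) * ?S t)" for t
  have k: "0 < k" using i by auto
  have f: "f t = mat (2 * k) (2 * k) (\<lambda>(r, j). (if j < k then x $ (2 * t + 2) else x $ (2 * t + 3)) *
      T $$ (r div k * k + lsesc_array Ls i (r mod k) (t + 1), j))" if "t < k" for t
  proof (cases "i = 0")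
    case True
    then show ?thesis by (auto simp: f_def lsesc_array_def signed_T_eq_mat[OF T])
  next
    case False
    then obtain l where l: "i = Suc l" by (cases i) auto
    then have "l < length Ls" using Ls i by auto
    then have L: "latin_square k (Ls ! l)" using Ls(2) by auto
    \<comment> \<open>The selected row has to lie inside the inner \<open>mat\<close>, since its
      entries can be evaluated only within its dimensions.\<close>
    have bd: "r div k * k + (Ls ! l $$ (r mod k, t) - 1) < 2 * k" if "r < 2 * k" for r
    proof -
      have "r mod k < k" using k by simp
      then have "1 \<le> Ls ! l $$ (r mod k, t)" "Ls ! l $$ (r mod k, t) \<le> k"
        using latin_square_entry[OF L] \<open>t < k\<close> by auto
      moreover have "r div k < 2" using that k by (simp add: less_mult_imp_div_less)
      then have "r div k * k \<le> 1 * k" by (intro mult_right_mono) auto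
      ultimately show ?thesis by linarith
    qed
    let ?x = "\<lambda>j. if j < k then x $ (2 * t + 2) else x $ (2 * t + 3)"
    have "f t = (1\<^sub>m 2 \<otimes>\<^sub>K (latin_tensor k (Ls ! l) ! t)) *
        mat (2 * k) (2 * k) (\<lambda>(r, j). ?x j * T $$ (r, j))"
      using l \<open>l < length Ls\<close> by (simp add: f_def signed_T_eq_mat[OF T] del: add_2_eq_Suc')
    also have "\<dots> = mat (2 * k) (2 * k) (\<lambda>(r, j).
        mat (2 * k) (2 * k) (\<lambda>(r, j). ?x j * T $$ (r, j))
          $$ (r div k * k + (Ls ! l $$ (r mod k, t) - 1), j))"
      by (rule latin_slice_mult_eq_mat[OF L \<open>t < k\<close>]) simp
    also have "\<dots> = mat (2 * k) (2 * k) (\<lambda>(r, j). ?x j *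
        T $$ (r div k * k + lsesc_array Ls i (r mod k) (t + 1), j))"
      by (rule cong_mat) (use bd l in \<open>simp_all add: lsesc_array_def\<close>)
    finally show ?thesis .
  qed
  have "hcat (2 * k) (map f [0..<k]) =
      mat (2 * k) (k * (2 * k)) (\<lambda>(r, c). f (c div (2 * k)) $$ (r, c mod (2 * k)))"
    using k by (subst hcat_eq_mat[where w = "2 * k"])
      (auto simp: f less_mult_imp_div_less intro!: eq_matI)
  also have "\<dots> = mat (2 * k) (k * (2 * k)) (\<lambda>(r, c). x $ (c div k + 2) *
      T $$ (r div k * k + lsesc_array Ls i (r mod k) (c div (2 * k) + 1), c mod (2 * k)))"
    (is "?l = ?r")
  proof (rule eq_matI)
    fix r c assume "r < dim_row ?r" "c < dim_col ?r"
    then have rc: "r < 2 * k" "c < k * (2 * k)" by auto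
    define u v where "u = c div (2 * k)" and "v = c mod (2 * k)"
    have uv: "c = u * (2 * k) + v" unfolding u_def v_def by (rule div_mult_mod_eq[symmetric])
    have v: "v < 2 * k" using k by (simp add: v_def)
    have "u < k" using rc by (simp add: u_def less_mult_imp_div_less)
    \<comment> \<open>Each block column contains two half blocks, each with its own sign. The shift
      by \<open>2\<close> in the sign index accounts for \<open>x $ 0\<close> and
      \<open>x $ 1\<close>, which belong to the \<open>E_block\<close>.\<close>
    have "c = v + (2 * u) * k" using uv by simp
    then have "c div k = 2 * u + v div k"
      using k by (simp only: div_mult_self1)
    moreover have "v div k = (if v < k then 0 else 1)"
      using v k by (simp add: le_div_geq)
    ultimately have e: "c div k + 2 = (if v < k then 2 * u + 2 else 2 * u + 3)" by simp
    have "?l $$ (r, c) = f u $$ (r, v)" using rc by (simp add: u_def v_def)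
    also have "\<dots> = x $ (if v < k then 2 * u + 2 else 2 * u + 3) *
        T $$ (r div k * k + lsesc_array Ls i (r mod k) (u + 1), v)"
      unfolding f[OF \<open>u < k\<close>] using rc v by simp
    also have "\<dots> = ?r $$ (r, c)" unfolding e[symmetric] using rc by (simp add: u_def v_def)
    finally show "?l $$ (r, c) = ?r $$ (r, c)" .
  qed auto
  finally have h: "hcat (2 * k) (map f [0..<k]) = \<dots>" .
  have "B_block_row k x T (map (latin_tensor k) Ls) i =
      E_block k T i (x $ 0) (x $ 1) @\<^sub>c hcat (2 * k) (map f [0..<k])"
    unfolding B_block_row_def f_def[abs_def] Let_def by simp
  also have "\<dots> = mat (2 * k) ((k + 1) * (2 * k))
    (\<lambda>(r, c). x $ (c div k) *
       T $$ (r div k * k + lsesc_array Ls i (r mod k) (c div (2 * k)), c mod (2 * k)))"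
    (is "_ = ?r")
    unfolding h E_block_eq_mat[OF T i]
  proof (subst append_cols_eq_mat[of _ "2 * k" "2 * k" _ "k * (2 * k)"], simp, simp, rule eq_matI, goal_cases)
    case (1 r c)
    then have rc: "r < 2 * k" "c < (k + 1) * (2 * k)" by simp_all
    show ?case
    proof (cases "c < 2 * k")
      case True
      then have "c div k = (if c < k then 0 else 1)" using k by (simp add: le_div_geq)
      then show ?thesis using rc True by (simp add: lsesc_array_def)
    next
      case False
      then obtain d where d: "c = d + 2 * k" by (metis add.commute le_Suc_ex not_less)
      have "c div k = d div k + 2" "c div (2 * k) = d div (2 * k) + 1" "c mod (2 * k) = d mod (2 * k)"
        using k unfolding d by auto
      moreover have "d < k * (2 * k)" using rc(2) unfolding d by simp
      ultimately show ?thesis using rc False d by simp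
    qed
  qed simp_all
  finally show ?thesis .
qed

section \<open>Inner products and half row sums of a \<open>T\<close>-submatrix\<close>

lemma pick_Compl_01: "pick (- {0, 1}) i = i + 2"
proof (induction i)
  case 0
  show ?case by (auto intro!: Least_equality)
next
  case (Suc i)
  then show ?case by (auto intro!: Least_equality)
qed

lemma submatrix_Compl_01:
  assumes "R \<in> carrier_mat n n"
  shows "submatrix R (- {0, 1}) (- {0, 1}) = mat (n - 2) (n - 2) (\<lambda>(i, j). R $$ (i + 2, j + 2))"
proof -
  have "{i. i < n \<and> i \<in> - {0, 1}} = {2..<n}" by auto
  then have "card {i. i < n \<and> i \<in> - {0, 1}} = n - 2" by simp
  then show ?thesis
    using assms unfolding submatrix_def pick_Compl_01 by auto
qed

text \<open>A column permutation only reorders the terms of a row product, and a row permutation,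
  being injective, keeps distinct row indices distinct.\<close>

lemma hadamard_permute_mat:
  assumes "hadamard n H" "p permutes {..<n}" "q permutes {..<n}"
  shows "hadamard n (permute_mat p q H)"
proof -
  have H: "H \<in> carrier_mat n n" "\<And>i j. i < n \<Longrightarrow> j < n \<Longrightarrow> H $$ (i, j) \<in> {1, -1}"
    "\<And>i i'. i < n \<Longrightarrow> i' < n \<Longrightarrow>
       (\<Sum>j<n. H $$ (i, j) * H $$ (i', j)) = (if i = i' then int n else 0)"
    using assms(1) by (auto simp: hadamard_iff)
  have pq: "p i < n \<longleftrightarrow> i < n" "q i < n \<longleftrightarrow> i < n" for i
    using permutes_in_image[OF assms(2), of i] permutes_in_image[OF assms(3), of i] by auto
  have "(\<Sum>j<n. permute_mat p q H $$ (i, j) * permute_mat p q H $$ (i', j))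
      = (if i = i' then int n else 0)" if "i < n" "i' < n" for i i'
  proof -
    have "(\<Sum>j<n. permute_mat p q H $$ (i, j) * permute_mat p q H $$ (i', j)) =
      (\<Sum>j<n. H $$ (p i, q j) * H $$ (p i', q j))"
      using that H(1) by (intro sum.cong) (auto simp: permute_mat_def)
    also have "\<dots> = (\<Sum>j<n. H $$ (p i, j) * H $$ (p i', j))"
      using sum.permute[OF assms(3), of "\<lambda>j. H $$ (p i, j) * H $$ (p i', j)"] by (simp add: o_def)
    also have "\<dots> = (if i = i' then int n else 0)"
      using H(3) that pq inj_eq[OF permutes_inj[OF assms(2)]] by auto
    finally show ?thesis .
  qed
  moreover have "permute_mat p q H \<in> carrier_mat n n"
    using H(1) by (auto simp: permute_mat_def)
  moreover have "permute_mat p q H $$ (i, j) \<in> {1, -1}" if "i < n" "j < n" for i j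
    using that H(1) H(2)[of "p i" "q j"] pq by (auto simp: permute_mat_def)
  ultimately show ?thesis unfolding hadamard_iff by blast
qed

lemma T_pattern_nth:
  assumes "j < 2 * k + 2"
  shows "T_pattern (2 * k + 2) $ j = (if j = 1 \<or> k + 2 \<le> j then -1 else 1)"
proof -
  consider "j = 0" | "j = 1" | l where "j = Suc (Suc l)" "l < 2 * k"
    using assms by (metis One_nat_def Suc_less_eq add_2_eq_Suc' not0_implies_Suc)
  then show ?thesis
    unfolding T_pattern_def vec_of_list_index by cases (auto simp: nth_append)
qed

text \<open>All sums come from orthogonality in the rearranged matrix \<open>R\<close> after
  removing its first two columns. For two lower rows these columns contribute \<open>2\<close> if
  the rows belong to the same half and \<open>0\<close> otherwise. Orthogonality to rows
  \<open>0\<close> and \<open>1\<close> of \<open>R\<close> determines the sum and the difference of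
  the two half row sums.\<close>

lemma T_submatrix_properties:
  assumes H: "hadamard (2 * k + 2) H" and T: "T_submatrix (2 * k + 2) H T"
  shows T_submatrix_carrier: "T \<in> carrier_mat (2 * k) (2 * k)"
    and T_submatrix_entry: "\<And>i j. i < 2 * k \<Longrightarrow> j < 2 * k \<Longrightarrow> T $$ (i, j) \<in> {1, -1}"
    and T_submatrix_left_sum: "\<And>i. i < 2 * k \<Longrightarrow> (\<Sum>j<k. T $$ (i, j)) = -1"
    and T_submatrix_right_sum:
      "\<And>i. i < 2 * k \<Longrightarrow> (\<Sum>j<k. T $$ (i, k + j)) = (if i < k then -1 else 1)"
    and T_submatrix_rows: "\<And>i i'. i < 2 * k \<Longrightarrow> i' < 2 * k \<Longrightarrow>
      (\<Sum>j<2 * k. T $$ (i, j) * T $$ (i', j)) =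
        (if i = i' then 2 * int k + 2 else 0) - (if i < k \<longleftrightarrow> i' < k then 2 else 0)"
proof -
  let ?n = "2 * k + 2"
  obtain p q where pq: "p permutes {..<?n}" "q permutes {..<?n}"
    and R': "let R = permute_mat p q H in
            row R 0 = vec ?n (\<lambda>_. 1) \<and> col R 0 = vec ?n (\<lambda>_. 1) \<and>
            row R 1 = T_pattern ?n \<and> col R 1 = T_pattern ?n \<and>
            T = submatrix R (- {0, 1}) (- {0, 1})"
    using T unfolding T_submatrix_def by blast
  define R where "R = permute_mat p q H"
  have "hadamard ?n R" unfolding R_def by (rule hadamard_permute_mat[OF H pq])
  then have Rc: "R \<in> carrier_mat ?n ?n"
    and Re: "\<And>i j. i < ?n \<Longrightarrow> j < ?n \<Longrightarrow> R $$ (i, j) \<in> {1, -1}"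
    and Ro: "\<And>i i'. i < ?n \<Longrightarrow> i' < ?n \<Longrightarrow>
       (\<Sum>j<?n. R $$ (i, j) * R $$ (i', j)) = (if i = i' then int ?n else 0)"
    unfolding hadamard_iff by blast+
  have row0: "row R 0 = vec ?n (\<lambda>_. 1)" and col0: "col R 0 = vec ?n (\<lambda>_. 1)"
    and row1: "row R 1 = T_pattern ?n" and col1: "col R 1 = T_pattern ?n"
    and TR: "T = mat (2 * k) (2 * k) (\<lambda>(i, j). R $$ (i + 2, j + 2))"
    using R' submatrix_Compl_01[OF Rc] by (simp_all add: R_def Let_def)
  have R0: "R $$ (0, j) = 1" if "j < ?n" for j
    using arg_cong[OF row0, of "\<lambda>v. v $ j"] that Rc by simp
  have R1: "R $$ (1, j) = (if j = 1 \<or> k + 2 \<le> j then -1 else 1)" if "j < ?n" for j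
    using arg_cong[OF row1, of "\<lambda>v. v $ j"] that Rc T_pattern_nth[OF that] by simp
  have C0: "R $$ (i, 0) = 1" if "i < ?n" for i
    using arg_cong[OF col0, of "\<lambda>v. v $ i"] that Rc by simp
  have C1: "R $$ (i, 1) = (if i = 1 \<or> k + 2 \<le> i then -1 else 1)" if "i < ?n" for i
    using arg_cong[OF col1, of "\<lambda>v. v $ i"] that Rc T_pattern_nth[OF that] by simp
  show "T \<in> carrier_mat (2 * k) (2 * k)" by (simp add: TR)
  show "T $$ (i, j) \<in> {1, -1}" if "i < 2 * k" "j < 2 * k" for i j
    using Re[of "i + 2" "j + 2"] that by (simp add: TR)
  have split: "(\<Sum>j<?n. f j) = f 0 + f 1 + (\<Sum>j<2 * k. f (j + 2))" for f :: "nat \<Rightarrow> int"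
    using sum_lessThan_add[of f 2 "2 * k"] by (simp add: numeral_2_eq_2 add.commute)
  have halves: "(\<Sum>j<2 * k. f j) = (\<Sum>j<k. f j) + (\<Sum>j<k. f (k + j))" for f :: "nat \<Rightarrow> int"
    using sum_lessThan_add[of f k k] by (simp add: mult_2)
  show "(\<Sum>j<2 * k. T $$ (i, j) * T $$ (i', j)) =
        (if i = i' then 2 * int k + 2 else 0) - (if i < k \<longleftrightarrow> i' < k then 2 else 0)"
    if "i < 2 * k" "i' < 2 * k" for i i'
    using Ro[of "i + 2" "i' + 2", unfolded split] that
    by (auto simp: C0 C1[unfolded One_nat_def] TR not_less split: if_splits)
  show "(\<Sum>j<k. T $$ (i, j)) = -1"
    and "(\<Sum>j<k. T $$ (i, k + j)) = (if i < k then -1 else 1)" if i: "i < 2 * k" for i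
  proof -
    define a b where "a = (\<Sum>j<k. T $$ (i, j))" and "b = (\<Sum>j<k. T $$ (i, k + j))"
    have "(\<Sum>j<2 * k. R $$ (i + 2, j + 2) * R $$ (0, j + 2)) = a + b"
      unfolding halves a_def b_def using i by (simp add: R0 TR)
    moreover have "(\<Sum>j<2 * k. R $$ (i + 2, j + 2) * R $$ (1, j + 2)) = a - b"
      unfolding halves a_def b_def using i by (simp add: R1[unfolded One_nat_def] TR sum_negf)
    \<comment> \<open>The first two terms are the contributions of columns \<open>0\<close> and
      \<open>1\<close> of \<open>R\<close>; the entry \<open>-1\<close> of row \<open>1\<close> in
      column \<open>1\<close> changes the sign in the second equation.\<close>
    ultimately have "1 + R $$ (i + 2, 1) + (a + b) = 0" "1 - R $$ (i + 2, 1) + (a - b) = 0"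
      using Ro[of "i + 2" 0, unfolded split] Ro[of "i + 2" 1, unfolded split] i
      by (auto simp: R0 R1[unfolded One_nat_def] C0)
    then show "a = -1" "b = (if i < k then -1 else 1)"
      using C1[of "i + 2"] i by (auto split: if_splits)
  qed
qed

section \<open>From tensors back to Latin squares, and the orthogonal array\<close>

text \<open>The symbol at \<open>(i, t)\<close> is recovered from the position of the
  \<open>1\<close> in row \<open>i\<close> of slice \<open>t\<close>.\<close>

lemma inj_on_latin_tensor: "inj_on (latin_tensor k) {L. latin_square k L}"
proof (rule inj_onI)
  fix L L' assume "L \<in> {L. latin_square k L}" "L' \<in> {L. latin_square k L}"
    and eq: "latin_tensor k L = latin_tensor k L'"
  then have L: "latin_square k L" and L': "latin_square k L'" by auto
  show "L = L'"
  proof (rule eq_matI)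
    fix i t assume "i < dim_row L'" "t < dim_col L'"
    then have it: "i < k" "t < k" using L' by (auto simp: latin_square_def)
    obtain j where j: "L $$ (i, t) = j + 1" "j < k"
      using latin_square_entry[OF L it] by (cases "L $$ (i, t)") auto
    have "latin_tensor k L ! t $$ (i, j) = 1" using it j by (simp add: latin_tensor_def)
    then have "latin_tensor k L' ! t $$ (i, j) = 1" using eq by simp
    then have "L' $$ (i, t) = j + 1"
      using it j by (simp add: latin_tensor_def split: if_splits)
    then show "L $$ (i, t) = L' $$ (i, t)" using j by simp
  qed (use L L' in \<open>auto simp: latin_square_def\<close>)
qed

text \<open>Injectivity of \<open>latin_tensor\<close> lets any enumeration of the tensors be pulled
  back to an enumeration of the Latin squares in the same order, without repetitions and hence of
  length \<open>k - 1\<close>.\<close>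

lemma complete_tensor_set_lists:
  assumes "complete_tensor_set k \<X>" "distinct Xs" "set Xs = \<X>"
  obtains Ls where "Xs = map (latin_tensor k) Ls" "length Ls = k - 1" "distinct Ls"
    "complete_lsesc k (set Ls)"
proof -
  obtain \<L> where \<L>: "complete_lsesc k \<L>" "\<X> = latin_tensor k ` \<L>"
    using assms(1) unfolding complete_tensor_set_def by blast
  then have inj: "inj_on (latin_tensor k) \<L>"
    by (intro inj_on_subset[OF inj_on_latin_tensor]) (auto simp: complete_lsesc_def)
  define Ls where "Ls = map (inv_into \<L> (latin_tensor k)) Xs"
  have 1: "Xs = map (latin_tensor k) Ls"
    unfolding Ls_def map_map
    by (rule map_idI[symmetric]) (use assms(3) \<L>(2) in \<open>auto intro: f_inv_into_f\<close>)
  have 2: "set Ls = \<L>"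
    unfolding Ls_def set_map assms(3) \<L>(2) by (simp add: inv_into_image_cancel inj)
  have 3: "distinct Ls" using assms(2) unfolding 1 by (simp add: distinct_map)
  have "length Ls = k - 1"
    using distinct_card[OF 3] \<L>(1) by (simp add: 2 complete_lsesc_def)
  then show thesis using that 1 2 3 \<L>(1) by blast
qed

lemma lsesc_array_less:
  assumes "length Ls = k - 1" "\<forall>L\<in>set Ls. latin_square k L" "i < k" "a < k" "u < k + 1"
  shows "lsesc_array Ls i a u < k"
proof (cases "u = 0 \<or> i = 0")
  case False
  then have "latin_square k (Ls ! (i - 1))" using assms by auto
  moreover have "u - 1 < k" using False assms(5) by linarith
  ultimately have "1 \<le> Ls ! (i - 1) $$ (a, u - 1)" "Ls ! (i - 1) $$ (a, u - 1) \<le> k"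
    using latin_square_entry assms(4) by blast+
  then have "Ls ! (i - 1) $$ (a, u - 1) - 1 < k" by linarith
  then show ?thesis using False by (simp add: lsesc_array_def)
qed (use assms in \<open>auto simp: lsesc_array_def\<close>)

lemma card_Ex1:
  assumes "\<exists>!u. P u"
  shows "card {u. P u} = 1"
proof -
  from assms obtain v where "P v" "\<forall>u. P u \<longrightarrow> u = v" by (rule ex1E)
  then have "P u \<longleftrightarrow> u = v" for u by metis
  then show ?thesis by simp
qed

lemma latin_square_row:
  assumes "latin_square k L" "i < k" "s < k"
  shows "\<exists>!j. j < k \<and> L $$ (i, j) = s + 1"
proof -
  have "\<forall>i<k. \<forall>s\<in>{1..k}. \<exists>!j. j < k \<and> L $$ (i, j) = s"
    using assms(1) unfolding latin_square_def by (elim conjE)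
  moreover have "s + 1 \<in> {1..k}" using assms(3) by simp
  ultimately show ?thesis using assms(2) by simp
qed

lemma latin_square_col_inj:
  assumes "latin_square k L" "j < k" "i < k" "i' < k" "L $$ (i, j) = L $$ (i', j)"
  shows "i = i'"
proof -
  have "\<forall>j<k. \<forall>s\<in>{1..k}. \<exists>!i. i < k \<and> L $$ (i, j) = s"
    using assms(1) unfolding latin_square_def by (elim conjE)
  moreover have "L $$ (i, j) \<in> {1..k}"
    using latin_square_entry[OF assms(1,3,2)] by simp
  ultimately have "\<exists>!m. m < k \<and> L $$ (m, j) = L $$ (i, j)"
    using assms(2) by simp
  then show ?thesis using assms(3-5) by metis
qed

text \<open>If \<open>i = i'\<close> and \<open>a\<close> differs from \<open>a'\<close>, the two
  rows of the array agree in column \<open>0\<close> and nowhere else, because a column of a Latin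
  square repeats no symbol. If \<open>i\<close> differs from \<open>i'\<close>, column
  \<open>0\<close> disagrees, and the single agreement comes from the LSESC condition or, when one
  index is \<open>0\<close>, from a symbol occurring once in a row of a Latin square.\<close>

lemma lsesc_array_agreement:
  assumes Ls: "length Ls = k - 1" "distinct Ls" "complete_lsesc k (set Ls)"
    and "i < k" "a < k" "i' < k" "a' < k"
  shows "card {u. u < k + 1 \<and> lsesc_array Ls i a u = lsesc_array Ls i' a' u} =
    (if i = i' \<and> a = a' then k + 1 else 1)"
proof -
  let ?A = "{u. u < k + 1 \<and> lsesc_array Ls i a u = lsesc_array Ls i' a' u}"
  let ?B = "{t. t < k \<and> lsesc_array Ls i a (Suc t) = lsesc_array Ls i' a' (Suc t)}"
  have pred_eq: "L $$ (a, t) - 1 = L' $$ (a', t) - 1 \<longleftrightarrow> L $$ (a, t) = L' $$ (a', t)"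
    if "latin_square k L" "latin_square k L'" "t < k" for L L' t
    using latin_square_entry(1)[OF that(1) \<open>a < k\<close> that(3)]
      latin_square_entry(1)[OF that(2) \<open>a' < k\<close> that(3)] by linarith
  have lat: "latin_square k (Ls ! l)" if "l < k - 1" for l
    using Ls that by (auto simp: complete_lsesc_def)
  \<comment> \<open>Column \<open>0\<close> carries the block row index itself, so it is split off;
    \<open>?B\<close> collects the agreements in the other \<open>k\<close> columns, shifted down by
    one.\<close>
  have A: "?A = (if i = i' then {0} else {}) \<union> Suc ` ?B"
    (is "_ = ?C")
  proof (rule Set.set_eqI)
    fix u show "u \<in> ?A \<longleftrightarrow> u \<in> ?C"
    proof (cases u)
      case 0
      then show ?thesis by (simp add: lsesc_array_def image_iff)
    next
      case (Suc t)
      then show ?thesis by (auto split: if_splits)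
    qed
  qed
  have "card ?A = (if i = i' then 1 else 0) + card ?B"
    unfolding A by (subst card_Un_disjoint) (auto simp: card_image)
  moreover have "card ?B = (if i = i' then if a = a' then k else 0 else 1)"
  proof -
    \<comment> \<open>Index \<open>0\<close> is separated because the block row without a tensor has
      the constant value \<open>a\<close> in all columns after the first, whereas
      \<open>Suc l\<close> refers to the Latin square \<open>Ls ! l\<close>.\<close>
    consider "i = i'" "a = a'" | "i = 0" "i' = 0" "a \<noteq> a'" | l where "i = Suc l" "i' = Suc l" "a \<noteq> a'"
      | l where "i = 0" "i' = Suc l" | l where "i = Suc l" "i' = 0"
      | l l' where "i = Suc l" "i' = Suc l'" "l \<noteq> l'"
      by (cases i; cases i') auto
    then show ?thesis
    proof cases
      case 3
      then have L: "latin_square k (Ls ! l)" using \<open>i < k\<close> lat[of l] by simp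
      have "Ls ! l $$ (a, t) - 1 \<noteq> Ls ! l $$ (a', t) - 1" if "t < k" for t
        using pred_eq[OF L L that] latin_square_col_inj[OF L that \<open>a < k\<close> \<open>a' < k\<close>] 3(3) by blast
      then have "?B = {}" by (simp add: 3 lsesc_array_def)
      then show ?thesis using 3 by simp
    next
      case 4
      then have L: "latin_square k (Ls ! l)" using \<open>i' < k\<close> lat[of l] by simp
      have "a = Ls ! l $$ (a', t) - 1 \<longleftrightarrow> Ls ! l $$ (a', t) = a + 1" if "t < k" for t
        using latin_square_entry(1)[OF L \<open>a' < k\<close> that] by linarith
      then have "?B = {t. t < k \<and> Ls ! l $$ (a', t) = a + 1}"
        by (simp add: 4 lsesc_array_def cong: conj_cong)
      then show ?thesis
        using card_Ex1[OF latin_square_row[OF L \<open>a' < k\<close> \<open>a < k\<close>]] 4 by simp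
    next
      case 5
      then have L: "latin_square k (Ls ! l)" using \<open>i < k\<close> lat[of l] by simp
      have "Ls ! l $$ (a, t) - 1 = a' \<longleftrightarrow> Ls ! l $$ (a, t) = a' + 1" if "t < k" for t
        using latin_square_entry(1)[OF L \<open>a < k\<close> that] by linarith
      then have "?B = {t. t < k \<and> Ls ! l $$ (a, t) = a' + 1}"
        by (simp add: 5 lsesc_array_def cong: conj_cong)
      then show ?thesis
        using card_Ex1[OF latin_square_row[OF L \<open>a < k\<close> \<open>a' < k\<close>]] 5 by simp
    next
      case 6
      then have ll: "l < k - 1" "l' < k - 1" using \<open>i < k\<close> \<open>i' < k\<close> by simp_all
      note L = lat[OF ll(1)] lat[OF ll(2)]
      have "Ls ! l \<noteq> Ls ! l'" using ll 6 Ls(1,2) by (simp add: nth_eq_iff_index_eq)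
      then have "lsesc k (Ls ! l) (Ls ! l')"
        using ll Ls(1,3) by (simp add: complete_lsesc_def)
      then have "\<exists>!t. t < k \<and> Ls ! l $$ (a, t) = Ls ! l' $$ (a', t)"
        using \<open>a < k\<close> \<open>a' < k\<close> by (simp add: lsesc_def)
      moreover have "?B = {t. t < k \<and> Ls ! l $$ (a, t) = Ls ! l' $$ (a', t)}"
        using pred_eq[OF L] by (simp add: 6 lsesc_array_def cong: conj_cong)
      ultimately show ?thesis using 6 by (simp add: card_Ex1)
    qed (simp_all add: lsesc_array_def)
  qed
  ultimately show ?thesis by simp
qed

section \<open>Balanced rows of Hadamard matrices and the column permutation of
  \<open>G\<close>\<close>

text \<open>Adding \<open>1\<close> to every sign turns the vanishing sum into twice the number of
  positive signs.\<close>

lemma card_signs_sum_zero: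
  fixes g :: "nat \<Rightarrow> int"
  assumes "\<And>j. j < n \<Longrightarrow> g j \<in> {1, -1}" "(\<Sum>j<n. g j) = 0"
  shows "n = 2 * card {j. j < n \<and> g j = 1}"
proof -
  have "int n = (\<Sum>j<n. g j + 1)" using assms(2) by (simp add: sum.distrib)
  also have "\<dots> = (\<Sum>j<n. if g j = 1 then 2 else 0)"
  proof (rule sum.cong)
    show "g j + 1 = (if g j = 1 then 2 else 0)" if "j \<in> {..<n}" for j
      using assms(1)[of j] that by auto
  qed simp
  also have "\<dots> = 2 * int (card {j. j < n \<and> g j = 1})"
    by (simp add: sum.If_cases Int_def)
  finally show ?thesis by linarith
qed

text \<open>The complements of \<open>A\<close> and \<open>B\<close> in \<open>S\<close> also have
  equal size, so a bijection from \<open>A\<close> to \<open>B\<close> can be glued to one between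
  the complements and extended by the identity outside \<open>S\<close>.\<close>

lemma permutes_onto_subset:
  assumes "finite S" "A \<subseteq> S" "B \<subseteq> S" "card A = card B"
  obtains q where "q permutes S" "\<And>x. x \<in> S \<Longrightarrow> q x \<in> B \<longleftrightarrow> x \<in> A"
proof -
  have fin: "finite A" "finite B" using assms finite_subset by metis+
  obtain f where f: "bij_betw f A B" using finite_same_card_bij[OF fin assms(4)] by metis
  have "card (S - A) = card (S - B)"
    using assms fin by (simp add: card_Diff_subset)
  then obtain g where g: "bij_betw g (S - A) (S - B)"
    using finite_same_card_bij[of "S - A" "S - B"] assms(1) by auto
  define q where "q x = (if x \<in> A then f x else if x \<in> S then g x else x)" for x
  have "bij_betw q A B" using f by (rule bij_betw_cong[THEN iffD1, rotated]) (simp add: q_def)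
  moreover have "bij_betw q (S - A) (S - B)"
    using g by (rule bij_betw_cong[THEN iffD1, rotated]) (simp add: q_def)
  ultimately have "bij_betw q (A \<union> (S - A)) (B \<union> (S - B))"
    by (rule bij_betw_combine) simp
  moreover have "A \<union> (S - A) = S" "B \<union> (S - B) = S" using assms by auto
  ultimately have "bij_betw q S S" by simp
  then have "q permutes S"
    using assms(2) by (intro bij_imp_permutes) (auto simp: q_def)
  moreover have "q x \<in> B \<longleftrightarrow> x \<in> A" if "x \<in> S" for x
    using that bij_betwE[OF f] bij_betwE[OF g] by (cases "x \<in> A") (simp_all add: q_def)
  ultimately show thesis by (rule that)
qed

lemma hadamard_row:
  assumes M: "hadamard n M" and v: "v \<in> set (rows M)"
  shows "dim_vec v = n" "\<And>j. j < n \<Longrightarrow> v $ j \<in> {1, -1}" "\<And>j. j < n \<Longrightarrow> v $ j * v $ j = 1"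
proof -
  from M have "dim_row M = n" "dim_col M = n" by (auto simp: hadamard_def)
  with v obtain i where i: "i < n" "v = row M i" by (auto simp: rows_def)
  show "dim_vec v = n" using i \<open>dim_col M = n\<close> by simp
  show *: "v $ j \<in> {1, -1}" if "j < n" for j
    using M i that \<open>dim_row M = n\<close> \<open>dim_col M = n\<close> by (simp add: hadamard_iff)
  show "v $ j * v $ j = 1" if "j < n" for j
    using *[OF that] by auto
qed

text \<open>Rows appear as vectors instead of indices because the two deleted rows are given as
  vectors \<open>x\<close> and \<open>alternate x\<close>.\<close>

lemma hadamard_row_product:
  assumes M: "hadamard n M" and v: "v \<in> set (rows M)" and w: "w \<in> set (rows M)"
  shows "(\<Sum>j<n. v $ j * w $ j) = (if v = w then int n else 0)"
proof -
  from M have dims: "dim_row M = n" "dim_col M = n" by (auto simp: hadamard_def)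
  with v obtain i where i: "i < n" "v = row M i" by (auto simp: rows_def)
  from dims w obtain i' where i': "i' < n" "w = row M i'" by (auto simp: rows_def)
  have "(\<Sum>j<n. v $ j * w $ j) = (\<Sum>j<n. M $$ (i, j) * M $$ (i', j))"
    using i i' dims by simp
  then have sum: "(\<Sum>j<n. v $ j * w $ j) = (if i = i' then int n else 0)"
    using M i(1) i'(1) by (simp add: hadamard_iff)
  show ?thesis
  proof (cases "v = w")
    case True
    then show ?thesis using hadamard_row(3)[OF M w] by simp
  next
    case False
    then have "i \<noteq> i'" using i i' by auto
    then show ?thesis using sum False by simp
  qed
qed

text \<open>Equal rows at different indices would have inner product both \<open>n\<close> and
  \<open>0\<close>. Distinctness ensures that filtering by value deletes only one copy of a
  row.\<close>

lemma hadamard_distinct_rows: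
  assumes M: "hadamard n M"
  shows "distinct (rows M)" "length (rows M) = n"
proof -
  from M have dims: "dim_row M = n" "dim_col M = n" by (auto simp: hadamard_def)
  then show "length (rows M) = n" by simp
  have "row M i \<noteq> row M i'" if "i < n" "i' < n" "i \<noteq> i'" for i i'
  proof
    assume eq: "row M i = row M i'"
    have "M $$ (i, j) = M $$ (i', j)" if "j < n" for j
      using arg_cong[OF eq, of "\<lambda>v. v $ j"] that \<open>i < n\<close> \<open>i' < n\<close> dims by simp
    then have "(\<Sum>j<n. M $$ (i, j) * M $$ (i, j)) = (\<Sum>j<n. M $$ (i, j) * M $$ (i', j))"
      by simp
    then show False using M that by (simp add: hadamard_iff)
  qed
  then show "distinct (rows M)" using dims by (simp add: distinct_conv_nth)
qed

lemma column_permutation_hadamard: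
  assumes "hadamard n G" "column_permutation_of Gt G"
  shows "hadamard n Gt"
proof -
  obtain q where "q permutes {..<dim_col G}" "Gt = permute_mat id q G"
    using assms(2) unfolding column_permutation_of_def by metis
  moreover have "dim_col G = n" using assms(1) by (auto simp: hadamard_def)
  ultimately show ?thesis
    using hadamard_permute_mat[OF assms(1) permutes_id] by metis
qed

text \<open>The row sum is the inner product with row \<open>0\<close>, which consists of
  ones.\<close>

lemma normalized_hadamard_row_sum:
  assumes "G \<in> normalized_hadamard n" "0 < i" "i < n"
  shows "(\<Sum>j<n. G $$ (i, j)) = 0"
proof -
  have h: "hadamard n G" and r: "row G 0 = vec n (\<lambda>_. 1)"
    using assms(1) by (auto simp: normalized_hadamard_def)
  have "G \<in> carrier_mat n n" using h by (simp add: hadamard_def)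
  then have "G $$ (0, j) = 1" if "j < n" for j
    using arg_cong[OF r, of "\<lambda>v. v $ j"] that by simp
  moreover have "(\<Sum>j<n. G $$ (i, j) * G $$ (0, j)) = 0"
    using h assms(2,3) by (simp add: hadamard_iff)
  ultimately show ?thesis by simp
qed

lemma normalized_hadamard_even:
  assumes "G \<in> normalized_hadamard n" "n \<ge> 2"
  shows "even n"
proof -
  have "n = 2 * card {j. j < n \<and> G $$ (1, j) = 1}"
    using assms normalized_hadamard_row_sum[OF assms(1), of 1]
    by (intro card_signs_sum_zero) (auto simp: normalized_hadamard_def hadamard_iff)
  then show ?thesis by (metis dvd_triv_left)
qed

text \<open>Row \<open>1\<close> is balanced, so a column permutation can place its positive entries
  at the even positions. Row \<open>0\<close>, being constant, is unchanged, and row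
  \<open>1\<close> becomes its alternating version.\<close>

lemma exists_alternating_rows:
  assumes G: "G \<in> normalized_hadamard n" and "n \<ge> 2"
  shows "\<exists>Gt. column_permutation_of Gt G \<and> (\<exists>x \<in> set (rows Gt). alternate x \<in> set (rows Gt))"
proof -
  have h: "hadamard n G" and r: "row G 0 = vec n (\<lambda>_. 1)"
    using G by (auto simp: normalized_hadamard_def)
  have Gc: "dim_row G = n" "dim_col G = n" using h by (auto simp: hadamard_def)
  have entry: "G $$ (1, j) \<in> {1, -1}" if "j < n" for j
    using h that \<open>n \<ge> 2\<close> by (simp add: hadamard_iff)
  have ones: "G $$ (0, j) = 1" if "j < n" for j
    using arg_cong[OF r, of "\<lambda>v. v $ j"] that Gc by simp
  let ?A = "{j. j < n \<and> (-1 :: int) ^ j = 1}" and ?B = "{j. j < n \<and> G $$ (1, j) = 1}"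
  obtain m where m: "n = 2 * m" using normalized_hadamard_even[OF assms] by blast
  have "(\<Sum>j<n. (-1 :: int) ^ j) = 0"
    unfolding m by (induction m) auto
  moreover have "(-1 :: int) ^ j \<in> {1, -1}" for j by (cases "even j") auto
  ultimately have "n = 2 * card ?A" by (intro card_signs_sum_zero)
  moreover have "n = 2 * card ?B"
    using normalized_hadamard_row_sum[OF G, of 1] \<open>n \<ge> 2\<close> entry
    by (intro card_signs_sum_zero) auto
  ultimately have "card ?A = card ?B" by linarith
  then obtain q where q: "q permutes {..<n}" "\<And>x. x \<in> {..<n} \<Longrightarrow> q x \<in> ?B \<longleftrightarrow> x \<in> ?A"
    using permutes_onto_subset[of "{..<n}" ?A ?B] by auto
  have qn: "q j < n" if "j < n" for j using permutes_in_image[OF q(1), of j] that by simp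
  let ?Gt = "permute_mat id q G"
  have row0: "row ?Gt 0 = vec n (\<lambda>_. 1)"
    using Gc \<open>n \<ge> 2\<close> qn ones by (intro eq_vecI) (simp_all add: permute_mat_def)
  have row1: "row ?Gt 1 = vec n (\<lambda>j. (-1) ^ j)"
  proof (rule eq_vecI)
    fix j assume "j < dim_vec (vec n (\<lambda>j. (-1 :: int) ^ j))"
    then have j: "j < n" by simp
    have "G $$ (1, q j) = 1 \<longleftrightarrow> (-1 :: int) ^ j = 1" using q(2)[of j] j qn[OF j] by simp
    moreover have "(-1 :: int) ^ j \<in> {1, -1}" by (cases "even j") auto
    ultimately have "G $$ (1, q j) = (-1) ^ j" using entry[OF qn[OF j]] by auto
    then show "row ?Gt 1 $ j = vec n (\<lambda>j. (-1) ^ j) $ j"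
      using j Gc \<open>n \<ge> 2\<close> by (simp add: permute_mat_def)
  qed (simp add: Gc permute_mat_def)
  have "alternate (row ?Gt 0) = row ?Gt 1"
    unfolding row0 row1 alternate_def by (intro eq_vecI) simp_all
  moreover have "row ?Gt 0 \<in> set (rows ?Gt)" "row ?Gt 1 \<in> set (rows ?Gt)"
    using Gc \<open>n \<ge> 2\<close> by (auto simp: rows_def permute_mat_def)
  moreover have "column_permutation_of ?Gt G"
    unfolding column_permutation_of_def using q(1) Gc by auto
  ultimately show ?thesis by metis
qed

section \<open>Closed forms of \<open>B_mat\<close> and \<open>B0_mat\<close> in global row and
  column indices\<close>

lemma div_half_eq: "r < 2 * k \<Longrightarrow> r div k = (if r < k then 0 else 1)" for r k :: nat
  by (simp add: le_div_geq)

text \<open>The row of \<open>T\<close> that row \<open>R\<close> of the whole matrix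
  \<open>B\<close> uses in block column \<open>u\<close>. The coordinates of \<open>R\<close> are
  its block row \<open>R div (2 * k)\<close>, its half \<open>R mod (2 * k) div k\<close> and its
  position in that half.\<close>

definition B_index :: "nat \<Rightarrow> nat mat list \<Rightarrow> nat \<Rightarrow> nat \<Rightarrow> nat" where
  "B_index k Ls R u =
     R mod (2 * k) div k * k + lsesc_array Ls (R div (2 * k)) (R mod (2 * k) mod k) u"

lemma B_mat_eq_mat:
  assumes k: "0 < k" and T: "T \<in> carrier_mat (2 * k) (2 * k)"
    and Ls: "length Ls = k - 1" "\<And>L. L \<in> set Ls \<Longrightarrow> latin_square k L"
  shows "B_mat (2 * k + 2) x T (map (latin_tensor k) Ls) =
    mat (k * (2 * k)) ((k + 1) * (2 * k))
      (\<lambda>(R, c). x $ (c div k) * T $$ (B_index k Ls R (c div (2 * k)), c mod (2 * k)))"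
proof -
  let ?r = "\<lambda>i. mat (2 * k) ((k + 1) * (2 * k)) (\<lambda>(r, c). x $ (c div k) *
       T $$ (r div k * k + lsesc_array Ls i (r mod k) (c div (2 * k)), c mod (2 * k)))"
  have "map (B_block_row k x T (map (latin_tensor k) Ls)) [0..<k] = map ?r [0..<k]"
    using B_block_row_eq_mat[OF T _ Ls] by simp
  note rows = this
  have "B_mat (2 * k + 2) x T (map (latin_tensor k) Ls) =
      vcat (k * (2 * k + 2)) (map (B_block_row k x T (map (latin_tensor k) Ls)) [0..<k])"
    by (simp add: B_mat_def)
  also note rows
  \<comment> \<open>The width is rewritten as \<open>k + 1\<close> block columns of width
    \<open>2 * k\<close>.\<close>
  also have "k * (2 * k + 2) = (k + 1) * (2 * k)" by simp
  also have "vcat ((k + 1) * (2 * k)) (map ?r [0..<k]) =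
      mat (length (map ?r [0..<k]) * (2 * k)) ((k + 1) * (2 * k))
        (\<lambda>(r, c). map ?r [0..<k] ! (r div (2 * k)) $$ (r mod (2 * k), c))"
    using k by (intro vcat_eq_mat) (simp, auto)
  also have "\<dots> = mat (k * (2 * k)) ((k + 1) * (2 * k))
      (\<lambda>(R, c). x $ (c div k) * T $$ (B_index k Ls R (c div (2 * k)), c mod (2 * k)))"
  proof (rule cong_mat)
    fix R c assume "R < length (map ?r [0..<k]) * (2 * k)" "c < (k + 1) * (2 * k)"
    then have Rc: "R < k * (2 * k)" "c < (k + 1) * (2 * k)" by simp_all
    have "R div (2 * k) < k" using Rc(1) by (simp add: less_mult_imp_div_less)
    moreover have "R mod (2 * k) < 2 * k" using k by simp
    ultimately show "(case (R, c) of (r, c) \<Rightarrow> map ?r [0..<k] ! (r div (2 * k)) $$ (r mod (2 * k), c)) =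
      (case (R, c) of (R, c) \<Rightarrow>
        x $ (c div k) * T $$ (B_index k Ls R (c div (2 * k)), c mod (2 * k)))"
      using Rc(2) by (simp only: prod.case nth_map length_upt nth_upt index_mat B_index_def) simp
  qed simp_all
  finally show ?thesis .
qed

text \<open>The array value stays below \<open>k\<close>, so adding it to the offset
  \<open>0\<close> or \<open>k\<close> never leaves the half. Which half of \<open>T\<close> is used
  thus depends on \<open>R\<close> alone and not on \<open>u\<close>.\<close>

lemma B_index_bounds:
  assumes "length Ls = k - 1" "complete_lsesc k (set Ls)" "R < k * (2 * k)" "u < k + 1"
  shows "B_index k Ls R u < 2 * k"
    and "B_index k Ls R u < k \<longleftrightarrow> R mod (2 * k) < k"
proof -
  have k: "0 < k" using assms(3) by (cases k) auto
  have "R div (2 * k) < k" using assms(3) by (simp add: less_mult_imp_div_less)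
  then have less: "lsesc_array Ls (R div (2 * k)) (R mod (2 * k) mod k) u < k"
    using assms k by (intro lsesc_array_less) (simp_all add: complete_lsesc_def)
  have "B_index k Ls R u = (if R mod (2 * k) < k then 0 else k) +
      lsesc_array Ls (R div (2 * k)) (R mod (2 * k) mod k) u"
    unfolding B_index_def using k by (subst div_half_eq) (simp_all only: mod_less_divisor, simp_all)
  then show "B_index k Ls R u < 2 * k" "B_index k Ls R u < k \<longleftrightarrow> R mod (2 * k) < k"
    using less by (simp_all split: if_splits)
qed

lemma div_mod_mod_eqD:
  fixes R R' :: nat
  assumes "R div (2 * k) = R' div (2 * k)" "R mod (2 * k) div k = R' mod (2 * k) div k"
    "R mod (2 * k) mod k = R' mod (2 * k) mod k"
  shows "R = R'"
  using assms by (metis div_mult_mod_eq)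

text \<open>Within one half the offsets cancel, block row and position of \<open>R\<close> form the
  pair \<open>(i, a)\<close>, and the count is that of the orthogonal array.\<close>

lemma B_index_agreement:
  assumes Ls: "length Ls = k - 1" "distinct Ls" "complete_lsesc k (set Ls)"
    and R: "R < k * (2 * k)" and R': "R' < k * (2 * k)"
    and half: "R mod (2 * k) < k \<longleftrightarrow> R' mod (2 * k) < k"
  shows "card {u. u < k + 1 \<and> B_index k Ls R u = B_index k Ls R' u} =
    (if R = R' then k + 1 else 1)"
proof -
  have k: "0 < k" using R by (cases k) auto
  have "R mod (2 * k) < 2 * k" "R' mod (2 * k) < 2 * k" using k by simp_all
  then have h: "R mod (2 * k) div k = R' mod (2 * k) div k"
    using half by (simp only: div_half_eq)
  have "R div (2 * k) < k" "R' div (2 * k) < k" using R R' by (simp_all add: less_mult_imp_div_less)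
  moreover have "R mod (2 * k) mod k < k" "R' mod (2 * k) mod k < k" using k by simp_all
  moreover have "R div (2 * k) = R' div (2 * k) \<and> R mod (2 * k) mod k = R' mod (2 * k) mod k \<longleftrightarrow> R = R'"
    using div_mod_mod_eqD[OF _ h] by metis
  ultimately show ?thesis
    using lsesc_array_agreement[OF Ls, of "R div (2 * k)" "R mod (2 * k) mod k"
        "R' div (2 * k)" "R' mod (2 * k) mod k"]
    unfolding B_index_def h by simp
qed

text \<open>The Kronecker product with a row of \<open>k\<close> ones repeats each entry
  \<open>k\<close> times in succession, hence the quotient \<open>c div k\<close>.\<close>

lemma B0_mat_eq_mat:
  assumes k: "0 < k"
    and gs: "filter (\<lambda>r. r \<noteq> x \<and> r \<noteq> alternate x) (rows Gt) = gs" "length gs = 2 * k"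
    "\<And>g. g \<in> set gs \<Longrightarrow> dim_vec g = 2 * k + 2"
  shows "B0_mat (2 * k + 2) Gt x =
    mat (2 * k) ((k + 1) * (2 * k)) (\<lambda>(i, c). gs ! i $ (c div k))"
proof -
  have "(2 * k + 2) * k = (k + 1) * (2 * k)" by simp
  then have d: "c div k < 2 * k + 2" if "c < (k + 1) * (2 * k)" for c
    using that by (metis less_mult_imp_div_less)
  show ?thesis
    unfolding B0_mat_def gs(1) kronecker_def ones_row_def mat_of_rows_def
    using k d by (intro eq_matI) (simp_all add: gs(2))
qed

text \<open>Position \<open>1\<close> carries a nonzero sign that \<open>alternate\<close> flips, so
  \<open>x\<close> and \<open>alternate x\<close> are two different rows and exactly two rows
  disappear.\<close>

lemma filter_rows_properties:
  assumes M: "hadamard n M" "n \<ge> 2" and x: "x \<in> set (rows M)" "alternate x \<in> set (rows M)"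
    and gs: "gs = filter (\<lambda>r. r \<noteq> x \<and> r \<noteq> alternate x) (rows M)"
  shows "length gs = n - 2" "distinct gs" "set gs = set (rows M) - {x, alternate x}"
proof -
  have "x $ 1 = 1 \<or> x $ 1 = -1" "dim_vec x = n"
    using hadamard_row[OF M(1) x(1)] \<open>n \<ge> 2\<close> by simp_all
  then have "alternate x $ 1 \<noteq> x $ 1" using \<open>n \<ge> 2\<close> by (auto simp: alternate_def)
  then have ne: "alternate x \<noteq> x" by metis
  show d: "distinct gs" using hadamard_distinct_rows(1)[OF M(1)] by (simp add: gs)
  show s: "set gs = set (rows M) - {x, alternate x}" by (auto simp: gs)
  have "card (set (rows M)) = n"
    using hadamard_distinct_rows[OF M(1)] by (simp add: distinct_card)
  then have "card (set gs) = n - 2"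
    unfolding s using x ne by (subst card_Diff_subset) simp_all
  then show "length gs = n - 2" using d by (simp add: distinct_card)
qed

section \<open>Inner products of the rows of the constructed matrix\<close>

lemma block_column_index:
  fixes k u v :: nat
  assumes "v < k"
  shows "(u * (2 * k) + v) div k = 2 * u" "(u * (2 * k) + (k + v)) div k = 2 * u + 1"
    "(u * (2 * k) + v) div (2 * k) = u" "(u * (2 * k) + (k + v)) div (2 * k) = u"
    "(u * (2 * k) + v) mod (2 * k) = v" "(u * (2 * k) + (k + v)) mod (2 * k) = k + v"
proof -
  have 1: "u * (2 * k) + v = v + (2 * u) * k" "u * (2 * k) + (k + v) = v + (2 * u + 1) * k" by simp_all
  show "(u * (2 * k) + v) div k = 2 * u" "(u * (2 * k) + (k + v)) div k = 2 * u + 1"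
    unfolding 1 using assms by (simp_all only: div_mult_self1) simp_all
  have 2: "u * (2 * k) + v = v + u * (2 * k)" "u * (2 * k) + (k + v) = (k + v) + u * (2 * k)" by simp_all
  show "(u * (2 * k) + v) div (2 * k) = u" "(u * (2 * k) + (k + v)) div (2 * k) = u"
    "(u * (2 * k) + v) mod (2 * k) = v" "(u * (2 * k) + (k + v)) mod (2 * k) = k + v"
    unfolding 2 using assms by simp_all
qed

text \<open>The arguments of \<open>f\<close> are the sign index, the block column and the column of
  \<open>T\<close>. On each half block the first two are constant, which is why the sum is split
  there.\<close>

lemma sum_block_columns:
  fixes f :: "nat \<Rightarrow> nat \<Rightarrow> nat \<Rightarrow> 'a::comm_monoid_add"
  shows "(\<Sum>c<(k + 1) * (2 * k). f (c div k) (c div (2 * k)) (c mod (2 * k))) =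
    (\<Sum>u<k + 1. (\<Sum>v<k. f (2 * u) u v) + (\<Sum>v<k. f (2 * u + 1) u (k + v)))"
proof -
  have split: "(\<Sum>v<2 * k. g v) = (\<Sum>v<k. g v) + (\<Sum>v<k. g (k + v))" for g :: "nat \<Rightarrow> 'a"
    using sum_lessThan_add[of g k k] by (simp add: mult_2)
  show ?thesis
    unfolding sum_lessThan_mult[of _ "k + 1" "2 * k"] split
    by (intro sum.cong refl arg_cong2[where f = "(+)"]) (simp_all only: lessThan_iff block_column_index)
qed

lemma sum_even_odd:
  fixes f :: "nat \<Rightarrow> 'a::comm_monoid_add"
  shows "(\<Sum>j<2 * m. f j) = (\<Sum>u<m. f (2 * u) + f (2 * u + 1))"
  by (induction m) (simp_all add: add.assoc)

text \<open>Every product \<open>g $ j * h $ j\<close> occurs once for each of the \<open>k\<close>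
  columns over which position \<open>j\<close> is repeated.\<close>

lemma B0_row_product:
  fixes g h :: "int vec"
  shows "(\<Sum>c<(k + 1) * (2 * k). g $ (c div k) * h $ (c div k)) =
    int k * (\<Sum>j<2 * k + 2. g $ j * h $ j)"
proof -
  have "(\<Sum>c<(k + 1) * (2 * k). g $ (c div k) * h $ (c div k)) =
    (\<Sum>u<k + 1. int k * (g $ (2 * u) * h $ (2 * u)) + int k * (g $ (2 * u + 1) * h $ (2 * u + 1)))"
    by (simp only: sum_block_columns[of "\<lambda>j _ _. g $ j * h $ j"] sum_constant card_lessThan of_nat_id)
  also have "\<dots> = int k * (\<Sum>j<2 * (k + 1). g $ j * h $ j)"
    unfolding sum_even_odd by (simp only: sum_distrib_left distrib_left)
  finally show ?thesis by simp
qed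

text \<open>Orthogonality to both \<open>x\<close> and \<open>alternate x\<close> amounts to orthogonality on the even and on
  the odd positions separately.\<close>

lemma B0_B_row_product:
  fixes T :: "int mat"
  assumes T: "\<And>i. i < 2 * k \<Longrightarrow> (\<Sum>j<k. T $$ (i, j)) = -1"
      "\<And>i. i < 2 * k \<Longrightarrow> (\<Sum>j<k. T $$ (i, k + j)) = (if i < k then -1 else 1)"
    and t: "\<And>u. u < k + 1 \<Longrightarrow> t u < 2 * k" "\<And>u. u < k + 1 \<Longrightarrow> t u < k \<longleftrightarrow> upper"
    and x: "dim_vec x = 2 * k + 2"
    and orth: "(\<Sum>j<2 * k + 2. g $ j * x $ j) = 0" "(\<Sum>j<2 * k + 2. g $ j * alternate x $ j) = 0"
  shows "(\<Sum>c<(k + 1) * (2 * k). g $ (c div k) * (x $ (c div k) * T $$ (t (c div (2 * k)), c mod (2 * k)))) = 0"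
proof -
  define a b where "a = (\<Sum>u<k + 1. g $ (2 * u) * x $ (2 * u))"
    and "b = (\<Sum>u<k + 1. g $ (2 * u + 1) * x $ (2 * u + 1))"
  have n: "2 * k + 2 = 2 * (k + 1)" by simp
  have "a + b = 0"
    using orth(1) unfolding n sum_even_odd a_def b_def by (simp only: sum.distrib)
  moreover have "a - b = 0"
  proof -
    have "(\<Sum>j<2 * k + 2. g $ j * alternate x $ j) = (\<Sum>j<2 * k + 2. g $ j * ((-1) ^ j * x $ j))"
      using x by (intro sum.cong) (simp_all add: alternate_def)
    also have "\<dots> = (\<Sum>u<k + 1. g $ (2 * u) * x $ (2 * u) - g $ (2 * u + 1) * x $ (2 * u + 1))"
      unfolding n sum_even_odd by (intro sum.cong) simp_all
    also have "\<dots> = a - b" unfolding a_def b_def by (rule sum_subtractf)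
    finally show ?thesis using orth(2) by simp
  qed
  ultimately have ab: "a = 0" "b = 0" by simp_all
  have "(\<Sum>c<(k + 1) * (2 * k). g $ (c div k) * (x $ (c div k) * T $$ (t (c div (2 * k)), c mod (2 * k)))) =
    (\<Sum>u<k + 1. (\<Sum>v<k. g $ (2 * u) * (x $ (2 * u) * T $$ (t u, v))) +
      (\<Sum>v<k. g $ (2 * u + 1) * (x $ (2 * u + 1) * T $$ (t u, k + v))))"
    by (rule sum_block_columns[of "\<lambda>j u v. g $ j * (x $ j * T $$ (t u, v))"])
  \<comment> \<open>The other factors are constant on a half block, so only the half row sums of
    \<open>T\<close> enter. These are the same for all selected rows, as they lie in a common
    half.\<close>
  also have "\<dots> = (\<Sum>u<k + 1. g $ (2 * u) * x $ (2 * u) * (-1) +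
      g $ (2 * u + 1) * x $ (2 * u + 1) * (if upper then -1 else 1))"
  proof (rule sum.cong)
    fix u assume "u \<in> {..<k + 1}"
    then have u: "u < k + 1" by simp
    show "(\<Sum>v<k. g $ (2 * u) * (x $ (2 * u) * T $$ (t u, v))) +
        (\<Sum>v<k. g $ (2 * u + 1) * (x $ (2 * u + 1) * T $$ (t u, k + v))) =
      g $ (2 * u) * x $ (2 * u) * (-1) + g $ (2 * u + 1) * x $ (2 * u + 1) * (if upper then -1 else 1)"
      by (simp only: mult.assoc[symmetric] sum_distrib_left[symmetric] T[OF t(1)[OF u]] t(2)[OF u])
  qed simp
  also have "\<dots> = - a + b * (if upper then -1 else 1)"
    unfolding a_def b_def by (simp only: sum.distrib sum_distrib_right sum_negf mult_minus_right mult_1_right)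
  also have "\<dots> = 0" using ab by simp
  finally show ?thesis .
qed

text \<open>The signs square to \<open>1\<close>, so a block column contributes the inner product of
  the two selected rows of \<open>T\<close>. With \<open>k + 1\<close> agreements the total is
  \<open>(2 * k + 2) * (k + 1) - 2 * (k + 1)\<close>, which equals \<open>k * (2 * k + 2)\<close>;
  with one agreement inside a half it is \<open>(2 * k + 2) - 2 * (k + 1)\<close>, which is
  \<open>0\<close>.\<close>

lemma B_row_product:
  fixes T :: "int mat"
  assumes T: "\<And>i i'. i < 2 * k \<Longrightarrow> i' < 2 * k \<Longrightarrow> (\<Sum>j<2 * k. T $$ (i, j) * T $$ (i', j)) =
        (if i = i' then 2 * int k + 2 else 0) - (if i < k \<longleftrightarrow> i' < k then 2 else 0)"
    and x: "\<And>j. j < 2 * k + 2 \<Longrightarrow> x $ j * x $ j = (1 :: int)"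
    and Ls: "length Ls = k - 1" "distinct Ls" "complete_lsesc k (set Ls)"
    and R: "R < k * (2 * k)" "R' < k * (2 * k)"
  shows "(\<Sum>c<(k + 1) * (2 * k).
      x $ (c div k) * T $$ (B_index k Ls R (c div (2 * k)), c mod (2 * k)) *
      (x $ (c div k) * T $$ (B_index k Ls R' (c div (2 * k)), c mod (2 * k)))) =
    (if R = R' then int (k * (2 * k + 2)) else 0)" (is "?lhs = _")
proof -
  let ?t = "B_index k Ls R" and ?t' = "B_index k Ls R'"
  let ?same = "R mod (2 * k) < k \<longleftrightarrow> R' mod (2 * k) < k"
  have "?lhs = (\<Sum>u<k + 1.
      (\<Sum>v<k. x $ (2 * u) * T $$ (?t u, v) * (x $ (2 * u) * T $$ (?t' u, v))) +
      (\<Sum>v<k. x $ (2 * u + 1) * T $$ (?t u, k + v) * (x $ (2 * u + 1) * T $$ (?t' u, k + v))))"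
    by (rule sum_block_columns[of "\<lambda>j u v. x $ j * T $$ (?t u, v) * (x $ j * T $$ (?t' u, v))"])
  also have "\<dots> = (\<Sum>u<k + 1.
      (if ?t u = ?t' u then 2 * int k + 2 else 0) - (if ?same then 2 else 0))"
  proof (rule sum.cong)
    fix u assume "u \<in> {..<k + 1}"
    then have u: "u < k + 1" by simp
    have sq: "y * T $$ (i, v) * (y * T $$ (i', v)) = T $$ (i, v) * T $$ (i', v)"
      if "y * y = (1 :: int)" for y i i' v
      using that by (metis mult.assoc mult.left_commute mult_1)
    have "x $ (2 * u) * x $ (2 * u) = 1" "x $ (2 * u + 1) * x $ (2 * u + 1) = 1"
      using u by (simp_all add: x)
    then have "(\<Sum>v<k. x $ (2 * u) * T $$ (?t u, v) * (x $ (2 * u) * T $$ (?t' u, v))) +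
      (\<Sum>v<k. x $ (2 * u + 1) * T $$ (?t u, k + v) * (x $ (2 * u + 1) * T $$ (?t' u, k + v))) =
      (\<Sum>v<k. T $$ (?t u, v) * T $$ (?t' u, v)) + (\<Sum>v<k. T $$ (?t u, k + v) * T $$ (?t' u, k + v))"
      by (simp only: sq)
    also have "\<dots> = (\<Sum>v<2 * k. T $$ (?t u, v) * T $$ (?t' u, v))"
      using sum_lessThan_add[of "\<lambda>v. T $$ (?t u, v) * T $$ (?t' u, v)" k k] by (simp add: mult_2)
    also have "\<dots> = (if ?t u = ?t' u then 2 * int k + 2 else 0) - (if ?same then 2 else 0)"
      using B_index_bounds[OF Ls(1,3) R(1) u] B_index_bounds[OF Ls(1,3) R(2) u] by (simp add: T)
    finally show "(\<Sum>v<k. x $ (2 * u) * T $$ (?t u, v) * (x $ (2 * u) * T $$ (?t' u, v))) +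
      (\<Sum>v<k. x $ (2 * u + 1) * T $$ (?t u, k + v) * (x $ (2 * u + 1) * T $$ (?t' u, k + v))) =
      (if ?t u = ?t' u then 2 * int k + 2 else 0) - (if ?same then 2 else 0)" .
  qed simp
  also have "\<dots> = (2 * int k + 2) * int (card {u. u < k + 1 \<and> ?t u = ?t' u}) -
      (if ?same then 2 * (int k + 1) else 0)"
  proof -
    have "(\<Sum>u<k + 1. if ?t u = ?t' u then 2 * int k + 2 else 0) =
      (2 * int k + 2) * int (card {u. u < k + 1 \<and> ?t u = ?t' u})"
      by (simp add: sum.If_cases Int_def del: sum.lessThan_Suc)
    then show ?thesis by (simp add: sum_subtractf del: sum.lessThan_Suc)
  qed
  also have "\<dots> = (if R = R' then int (k * (2 * k + 2)) else 0)"
  proof (cases ?same)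
    case True
    show ?thesis
      unfolding B_index_agreement[OF Ls R True] using True by (simp add: algebra_simps)
  next
    case False
    then have "R \<noteq> R'" by auto
    \<comment> \<open>Rows of \<open>B\<close> from different halves select from disjoint sets of
      rows of \<open>T\<close>, so they never agree.\<close>
    have "?t u \<noteq> ?t' u" if "u < k + 1" for u
      using B_index_bounds(2)[OF Ls(1,3) R(1) that] B_index_bounds(2)[OF Ls(1,3) R(2) that] False
      by metis
    then have "{u. u < k + 1 \<and> ?t u = ?t' u} = {}" by simp
    then show ?thesis using False \<open>R \<noteq> R'\<close> by simp
  qed
  finally show ?thesis .
qed

section \<open>Assembly of the two families of rows\<close>

lemma hadamard_Psi:
  assumes k: "0 < k"
    and Gt: "hadamard (2 * k + 2) Gt" "x \<in> set (rows Gt)" "alternate x \<in> set (rows Gt)"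
    and H: "hadamard (2 * k + 2) H" "T_submatrix (2 * k + 2) H T"
    and Ls: "length Ls = k - 1" "distinct Ls" "complete_lsesc k (set Ls)"
  shows "hadamard (k * (2 * k + 2)) (Psi (2 * k + 2) Gt x T (map (latin_tensor k) Ls))"
proof -
  let ?N = "(k + 1) * (2 * k)"
  define gs where "gs = filter (\<lambda>r. r \<noteq> x \<and> r \<noteq> alternate x) (rows Gt)"
  have gs: "length gs = 2 * k" "distinct gs" "set gs = set (rows Gt) - {x, alternate x}"
    using filter_rows_properties[OF Gt(1) _ Gt(2,3) gs_def] by simp_all
  then have gsG: "gs ! i \<in> set (rows Gt)" "gs ! i \<noteq> x" "gs ! i \<noteq> alternate x" if "i < 2 * k" for i
    using nth_mem[of i gs] that by auto
  note Tc = T_submatrix_carrier[OF H] and Te = T_submatrix_entry[OF H]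
    and Tl = T_submatrix_left_sum[OF H] and Tr = T_submatrix_right_sum[OF H]
    and To = T_submatrix_rows[OF H]
  have latin: "latin_square k L" if "L \<in> set Ls" for L
    using Ls(3) that by (simp add: complete_lsesc_def)
  define b where "b R c = x $ (c div k) * T $$ (B_index k Ls R (c div (2 * k)), c mod (2 * k))" for R c
  define M where "M = mat (2 * k + k * (2 * k)) ?N
    (\<lambda>(R, c). if R < 2 * k then gs ! R $ (c div k) else b (R - 2 * k) c)"
  have B0: "B0_mat (2 * k + 2) Gt x = mat (2 * k) ?N (\<lambda>(i, c). gs ! i $ (c div k))"
    using gs(1,3) hadamard_row(1)[OF Gt(1)] by (intro B0_mat_eq_mat[OF k gs_def[symmetric]]) simp_all
  have B: "B_mat (2 * k + 2) x T (map (latin_tensor k) Ls) = mat (k * (2 * k)) ?N (\<lambda>(R, c). b R c)"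
    unfolding b_def by (rule B_mat_eq_mat[OF k Tc Ls(1) latin])
  have Psi: "Psi (2 * k + 2) Gt x T (map (latin_tensor k) Ls) = M"
    unfolding Psi_def B0 B M_def
    by (subst append_rows_eq_mat[of _ "2 * k" ?N _ "k * (2 * k)"], simp, simp, rule cong_mat) auto
  \<comment> \<open>The order \<open>k * n\<close>, the \<open>k + 1\<close> block columns, and the
    \<open>2 * k\<close> rows of \<open>B0_mat\<close> above \<open>k\<close> block rows of
    \<open>B_mat\<close> all give the same number, so the matrix is square.\<close>
  have N: "k * (2 * k + 2) = ?N" "2 * k + k * (2 * k) = ?N" by simp_all
  have col: "c div k < 2 * k + 2" "c div (2 * k) < k + 1" "c mod (2 * k) < 2 * k" if "c < ?N" for c
  proof -
    have "?N = (2 * k + 2) * k" by simp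
    then show "c div k < 2 * k + 2" using that by (metis less_mult_imp_div_less)
    show "c div (2 * k) < k + 1" using that by (rule less_mult_imp_div_less)
    show "c mod (2 * k) < 2 * k" using k by simp
  qed
  have entry: "M $$ (R, c) \<in> {1, -1}" if "R < ?N" "c < ?N" for R c
  proof (cases "R < 2 * k")
    case True
    then show ?thesis
      using hadamard_row(2)[OF Gt(1) gsG(1)[OF True] col(1)[OF that(2)]] that by (simp add: M_def)
  next
    case False
    then have R: "R - 2 * k < k * (2 * k)" using that(1) by simp
    have "x $ (c div k) \<in> {1, -1}" by (rule hadamard_row(2)[OF Gt(1,2) col(1)[OF that(2)]])
    moreover have "T $$ (B_index k Ls (R - 2 * k) (c div (2 * k)), c mod (2 * k)) \<in> {1, -1}"
      using col[OF that(2)] by (intro Te B_index_bounds(1)[OF Ls(1,3) R])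
    ultimately have "b (R - 2 * k) c \<in> {1, -1}" unfolding b_def by auto
    then show ?thesis using False that by (simp add: M_def)
  qed
  have gg: "(\<Sum>c<?N. gs ! i $ (c div k) * gs ! i' $ (c div k)) = (if i = i' then int ?N else 0)"
    if "i < 2 * k" "i' < 2 * k" for i i'
    unfolding B0_row_product hadamard_row_product[OF Gt(1) gsG(1)[OF that(1)] gsG(1)[OF that(2)]]
    using that gs(1,2) by (simp add: nth_eq_iff_index_eq algebra_simps)
  have gb: "(\<Sum>c<?N. gs ! i $ (c div k) * b R c) = 0" if i: "i < 2 * k" and R: "R < k * (2 * k)" for i R
    unfolding b_def
  proof (rule B0_B_row_product)
    show "B_index k Ls R u < 2 * k" if "u < k + 1" for u
      using B_index_bounds(1)[OF Ls(1,3) R that] .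
    show "B_index k Ls R u < k \<longleftrightarrow> R mod (2 * k) < k" if "u < k + 1" for u
      using B_index_bounds(2)[OF Ls(1,3) R that] .
    show "dim_vec x = 2 * k + 2" by (rule hadamard_row(1)[OF Gt(1,2)])
    show "(\<Sum>j<2 * k + 2. gs ! i $ j * x $ j) = 0"
      using hadamard_row_product[OF Gt(1) gsG(1)[OF i] Gt(2)] gsG(2)[OF i] by simp
    show "(\<Sum>j<2 * k + 2. gs ! i $ j * alternate x $ j) = 0"
      using hadamard_row_product[OF Gt(1) gsG(1)[OF i] Gt(3)] gsG(3)[OF i] by simp
  qed (simp_all add: Tl Tr)
  have bb: "(\<Sum>c<?N. b R c * b R' c) = (if R = R' then int ?N else 0)"
    if "R < k * (2 * k)" "R' < k * (2 * k)" for R R'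
    unfolding b_def N(1)[symmetric] using B_row_product[OF To hadamard_row(3)[OF Gt(1,2)] Ls that]
    by (simp only: N(1))
  have "(\<Sum>c<?N. M $$ (R, c) * M $$ (R', c)) = (if R = R' then int ?N else 0)"
    if "R < ?N" "R' < ?N" for R R'
  proof -
    define m where "m R c = (if R < 2 * k then gs ! R $ (c div k) else b (R - 2 * k) c)" for R c
    have "(\<Sum>c<?N. M $$ (R, c) * M $$ (R', c)) = (\<Sum>c<?N. m R c * m R' c)"
      using that by (intro sum.cong) (simp_all add: M_def m_def)
    also have "\<dots> = (if R = R' then int ?N else 0)"
    proof (cases "R < 2 * k"; cases "R' < 2 * k")
      assume "R < 2 * k" "R' < 2 * k"
      then show ?thesis using gg[of R R'] by (simp only: m_def if_True)
    next
      assume "R < 2 * k" "\<not> R' < 2 * k"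
      moreover from this have "R' - 2 * k < k * (2 * k)" "R \<noteq> R'" using that by auto
      ultimately show ?thesis using gb[of R "R' - 2 * k"] by (simp only: m_def if_True if_False)
    next
      assume "\<not> R < 2 * k" "R' < 2 * k"
      moreover from this have "R - 2 * k < k * (2 * k)" "R \<noteq> R'" using that by auto
      ultimately show ?thesis using gb[of R' "R - 2 * k"]
        by (simp only: m_def if_True if_False mult.commute[of "b _ _"])
    next
      assume *: "\<not> R < 2 * k" "\<not> R' < 2 * k"
      then have "R - 2 * k < k * (2 * k)" "R' - 2 * k < k * (2 * k)" using that by auto
      moreover have "R - 2 * k = R' - 2 * k \<longleftrightarrow> R = R'" using * by auto
      ultimately show ?thesis using * bb[of "R - 2 * k" "R' - 2 * k"] by (simp only: m_def if_False)
    qed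
    finally show ?thesis .
  qed
  moreover have "M \<in> carrier_mat ?N ?N" unfolding M_def N(2) by simp
  ultimately show ?thesis
    unfolding Psi N(1) hadamard_iff using entry by simp
qed

theorem corollary5:
  fixes n :: nat and G H :: "int mat"
  assumes "n \<ge> 4"
    and "(G, H) \<in> normalized_hadamard n \<times> normalized_hadamard n"
  shows "(\<exists>Gt. column_permutation_of Gt G \<and>
            (\<exists>x \<in> set (rows Gt). alternate x \<in> set (rows Gt))) \<and>
         (\<forall>Gt x T \<X> Xs.
            column_permutation_of Gt G \<longrightarrow>
            x \<in> set (rows Gt) \<longrightarrow> alternate x \<in> set (rows Gt) \<longrightarrow>
            T_submatrix n H T \<longrightarrow>
            complete_tensor_set (n div 2 - 1) \<X> \<longrightarrow>
            distinct Xs \<longrightarrow> set Xs = \<X> \<longrightarrow>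
            hadamard ((n div 2 - 1) * n) (Psi n Gt x T Xs))"
proof (intro conjI allI impI)
  have G: "G \<in> normalized_hadamard n" and H: "H \<in> normalized_hadamard n"
    using assms(2) by simp_all
  show "\<exists>Gt. column_permutation_of Gt G \<and> (\<exists>x \<in> set (rows Gt). alternate x \<in> set (rows Gt))"
    using exists_alternating_rows[OF G] assms(1) by simp
  fix Gt x T \<X> Xs
  assume Gt: "column_permutation_of Gt G" "x \<in> set (rows Gt)" "alternate x \<in> set (rows Gt)"
    and T: "T_submatrix n H T"
    and Xs: "complete_tensor_set (n div 2 - 1) \<X>" "distinct Xs" "set Xs = \<X>"
  define k where "k = n div 2 - 1"
  have "even n" using normalized_hadamard_even[OF G] assms(1) by simp
  \<comment> \<open>Evenness makes the division by \<open>2\<close> exact, and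
    \<open>n \<ge> 4\<close> makes \<open>k\<close> positive.\<close>
  then have n: "n = 2 * k + 2" and k: "0 < k" using assms(1) by (auto simp: k_def)
  have hG: "hadamard n G" and hH: "hadamard n H"
    using G H by (simp_all add: normalized_hadamard_def)
  obtain Ls where Ls: "Xs = map (latin_tensor k) Ls" "length Ls = k - 1" "distinct Ls"
    "complete_lsesc k (set Ls)"
    using complete_tensor_set_lists[OF Xs] unfolding k_def .
  have "hadamard (k * (2 * k + 2)) (Psi (2 * k + 2) Gt x T (map (latin_tensor k) Ls))"
    using hadamard_Psi[OF k _ Gt(2,3) _ _ Ls(2-4)] column_permutation_hadamard[OF hG Gt(1)] hH T
    unfolding n by simp
  then show "hadamard ((n div 2 - 1) * n) (Psi n Gt x T Xs)"
    unfolding Ls(1) k_def[symmetric] n[symmetric] .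
qed

end
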